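(* Let $N>1$, $T>0$, and for $i=1,\dots,N$ let $A\in\mathbb{R}^{n\times n}$ be Metzler, $B_i\in\mathbb{R}^{n\times m_i}$, $E_i\in\mathbb{R}^{m_i\times n}$ entrywise nonnegative, $s_i\in\mathbb{R}^n_+$, $r_i\in\mathbb{R}^{m_i}$. Consider the differential game with dynamics $$\dot x(t)=Ax(t)+\sum_{i=1}^N B_iu_i(t),\qquad x(0)=x_0\in\mathbb{R}^n_+,$$ input constraints $|u_i(t)|\le E_ix(t)$, and cost functionals, for $(t,x)\in[0,T]\times\mathbb{R}^n_+$, $$C_i(t,x,u_1,\dots,u_N)=\int_t^T\big(s_i^\top x(\tau)+r_i^\top u_i(\tau)\big)\,d\tau ,$$ where $x(\cdot)$ solves the dynamics on $[t,T]$ with $x(t)=x$. Suppose that (1) $A-\sum_{i=1}^N|B_i|E_i$ is Metzler; (2) $s_i-E_i^\top|r_i|>0$ (entrywise) for all $i$; (3) there exist absolutely continuous functions $p_i:[0,T]\to\mathbb{R}^n$, $i=1,\dots,N$, with $p_i(T)=0$, satisfying for almost every $t\in[0,T]$ $$-\dot p_i(t)=s_i+A^\top p_i(t)-K_i(t)^\top\big(r_i+B_i^\top p_i(t)\big)-\sum_{j\ne i}K_j(t)^\top B_j^\top p_i(t),$$ where $K_i(t)=\mathrm{diag}\big(\mathrm{sign}(r_i+B_i^\top p_i(t))\big)E_i$; (4) for each $i$, every entry of $r_i+B_i^\top p_i(t)$ is nonzero for almost every $t\in[0,T]$. Then the feedback laws $u_i^*(t)=-K_i(t)x(t)$, $i=1,\dots,N$,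 define a feedback Nash equilibrium of the game. Moreover, the cost incurred by player $i$ at this equilibrium (from initial time $0$ and initial state $x_0$) is $p_i(0)^\top x_0$, $i=1,\dots,N$.
   Context: $\mathbb{R}^n_+$ is the set of vectors with nonnegative entries. Inequalities between vectors or matrices are entrywise, and $|X|$ is the entrywise absolute value. A square matrix is Metzler if its off-diagonal entries are nonnegative. For a vector $v$, $\mathrm{diag}(v)$ is the diagonal matrix with the entries of $v$ on the diagonal. The sign is applied entrywise; $\mathrm{sign}(y)=-1$ if $y<0$, $+1$ if $y>0$, and is the set $[-1,1]$ if $y=0$. By hypothesis (4), $K_i(t)$ is uniquely defined for almost every $t$; on the exceptional null set any value from the set may be used. Admissible feedback laws: a feedback law $\mu_i$ of player $i$ gives $u_i(t)=\mu_i(t,x(t))$ (possibly nonlinear in $x$) and is admissible if it satisfies the constraint $|\mu_i(t,x)|\le E_ix$ for $x\in\mathbb{R}^n_+$. Solutions of the dynamics are understood in the Carathéodory sense (absolutely continuous, satisfying the ODE almost everywhere). Costs are evaluated along such solutions, and feedback laws are considered only when the resulting closed loop admits such a solution on $[t,T]$ from each $(t,x)$. Feedback Nash equilibrium: a tuple of admissible feedback laws $(\mu_1^*,\dots,\mu_N^* )$ such that for every $i$, every admissible feedback law $\mu_i$ of player $i$, and all $(t,x)\in[0,T]\times\mathbb{R}^n_+$, $$C_i(t,x,\mu_1^*,\dots,\mu_i^*,\dots,\mu_N^* )\le C_i(t,x,\mu_1^*,\dots,\mu_i,\dots,\mu_N^* )$$ (if the closed loop under a deviation $\mu_i$ has several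 solutions, the inequality is for each of them). *)

theory Defs
  imports "HOL-Analysis.Analysis" "Jordan_Normal_Form.Matrix"
begin

(* The input dimensions m i differ from player to player, so vectors and matrices are the
   carrier-based ones of Jordan_Normal_Form; both libraries use the notations switched off here. *)
unbundle no inner_syntax
unbundle no vec_syntax

type_synonym rvec = "real Matrix.vec"
type_synonym rmat = "real Matrix.mat"

abbreviation vec_abs :: "rvec \<Rightarrow> rvec" where
  "vec_abs \<equiv> map_vec abs"

abbreviation mat_abs :: "rmat \<Rightarrow> rmat" where
  "mat_abs \<equiv> map_mat abs"

definition nonneg_orthant :: "nat \<Rightarrow> rvec set" where
  "nonneg_orthant n = {v \<in> carrier_vec n. 0\<^sub>v n \<le> v}"

(* The order "<" on vectors in the library is "\<le> and not equal", not the entrywise strict order. *)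
definition vec_pos :: "rvec \<Rightarrow> bool" where
  "vec_pos v \<longleftrightarrow> (\<forall>k<dim_vec v. 0 < v $ k)"

definition metzler :: "rmat \<Rightarrow> bool" where
  "metzler M \<longleftrightarrow> square_mat M \<and>
     (\<forall>k<dim_row M. \<forall>l<dim_row M. k \<noteq> l \<longrightarrow> 0 \<le> M $$ (k, l))"

definition mat_sum :: "nat \<Rightarrow> nat \<Rightarrow> ('i \<Rightarrow> rmat) \<Rightarrow> 'i set \<Rightarrow> rmat" where
  "mat_sum nr nc F I = mat nr nc (\<lambda>kl. \<Sum>i\<in>I. F i $$ kl)"

abbreviation vec_sum :: "nat \<Rightarrow> ('i \<Rightarrow> rvec) \<Rightarrow> 'i set \<Rightarrow> rvec" where
  "vec_sum \<equiv> finsum_vec TYPE(real)"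

definition diag_of_vec :: "rvec \<Rightarrow> rmat" where
  "diag_of_vec v = mat_diag (dim_vec v) (\<lambda>j. v $ j)"

definition sign_set :: "real \<Rightarrow> real set" where
  "sign_set y = (if y < 0 then {-1} else if y > 0 then {1} else {-1..1})"

definition sign_vec_set :: "rvec \<Rightarrow> rvec set" where
  "sign_vec_set y = {v \<in> carrier_vec (dim_vec y). \<forall>j<dim_vec y. v $ j \<in> sign_set (y $ j)}"

(* All admissible values of diag(sign(y)) E; a singleton as soon as no entry of y vanishes. *)
definition sign_gains :: "rmat \<Rightarrow> rvec \<Rightarrow> rmat set" where
  "sign_gains E y = {diag_of_vec v * E | v. v \<in> sign_vec_set y}"

(* Absolute continuity of a function; the library only has it for measures. *)
definition abs_cont_on :: "real \<Rightarrow> real \<Rightarrow> (real \<Rightarrow> real) \<Rightarrow> bool" where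
  "abs_cont_on a b f \<longleftrightarrow>
     (\<forall>\<epsilon>>0. \<exists>\<delta>>0. \<forall>(q::nat) l r.
        (\<forall>i<q. a \<le> l i \<and> l i \<le> r i \<and> r i \<le> b) \<and>
        disjoint_family_on (\<lambda>i. {l i<..<r i}) {..<q} \<and>
        (\<Sum>i<q. r i - l i) < \<delta> \<longrightarrow>
        (\<Sum>i<q. \<bar>f (r i) - f (l i)\<bar>) < \<epsilon>)"

definition vec_abs_cont_on :: "nat \<Rightarrow> real \<Rightarrow> real \<Rightarrow> (real \<Rightarrow> rvec) \<Rightarrow> bool" where
  "vec_abs_cont_on n a b f \<longleftrightarrow>
     (\<forall>\<tau>\<in>{a..b}. f \<tau> \<in> carrier_vec n) \<and> (\<forall>k<n. abs_cont_on a b (\<lambda>\<tau>. f \<tau> $ k))"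

(* The library vector type carries no topology, so derivatives are taken entrywise. *)
definition has_vec_deriv :: "(real \<Rightarrow> rvec) \<Rightarrow> rvec \<Rightarrow> real filter \<Rightarrow> bool" where
  "has_vec_deriv f v F \<longleftrightarrow>
     (\<forall>k<dim_vec v. ((\<lambda>\<tau>. f \<tau> $ k) has_real_derivative v $ k) F)"

type_synonym feedback = "real \<Rightarrow> rvec \<Rightarrow> rvec"

definition admissible_feedback :: "nat \<Rightarrow> real \<Rightarrow> rmat \<Rightarrow> feedback \<Rightarrow> bool" where
  "admissible_feedback n T E \<mu> \<longleftrightarrow>
     (\<forall>t\<in>{0..T}. \<forall>x\<in>nonneg_orthant n. vec_abs (\<mu> t x) \<le> E *\<^sub>v x)"

(* Caratheodory solutions on [t,T] of the closed loop under the profile \<mu>, from x at time t.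
   The input constraint is imposed along the trajectory. This is what keeps the state in the
   nonnegative orthant, outside of which the values of the total function \<mu> i are meaningless.
   The order \<le> on vectors includes equality of dimensions. *)
definition closed_loop_solution ::
  "nat \<Rightarrow> nat \<Rightarrow> real \<Rightarrow> rmat \<Rightarrow> (nat \<Rightarrow> rmat) \<Rightarrow> (nat \<Rightarrow> rmat) \<Rightarrow> (nat \<Rightarrow> feedback)
     \<Rightarrow> real \<Rightarrow> rvec \<Rightarrow> (real \<Rightarrow> rvec) \<Rightarrow> bool" where
  "closed_loop_solution N n T A B E \<mu> t x \<xi> \<longleftrightarrow>
     vec_abs_cont_on n t T \<xi> \<and> \<xi> t = x \<and>
     (\<forall>\<tau>\<in>{t..T}. \<forall>i<N. vec_abs (\<mu> i \<tau> (\<xi> \<tau>)) \<le> E i *\<^sub>v \<xi> \<tau>) \<and>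
     (AE \<tau>\<in>{t..T} in lebesgue.
        has_vec_deriv \<xi> (A *\<^sub>v \<xi> \<tau> + vec_sum n (\<lambda>i. B i *\<^sub>v \<mu> i \<tau> (\<xi> \<tau>)) {..<N})
          (at \<tau> within {t..T}))"

definition closed_loop_solvable ::
  "nat \<Rightarrow> nat \<Rightarrow> real \<Rightarrow> rmat \<Rightarrow> (nat \<Rightarrow> rmat) \<Rightarrow> (nat \<Rightarrow> rmat) \<Rightarrow> (nat \<Rightarrow> feedback) \<Rightarrow> bool" where
  "closed_loop_solvable N n T A B E \<mu> \<longleftrightarrow>
     (\<forall>t\<in>{0..T}. \<forall>x\<in>nonneg_orthant n. \<exists>\<xi>. closed_loop_solution N n T A B E \<mu> t x \<xi>)"

definition running_cost ::
  "(nat \<Rightarrow> rvec) \<Rightarrow> (nat \<Rightarrow> rvec) \<Rightarrow> (nat \<Rightarrow> feedback) \<Rightarrow> nat \<Rightarrow> (real \<Rightarrow> rvec) \<Rightarrow> real \<Rightarrow> real" where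
  "running_cost s r \<mu> i \<xi> \<tau> = s i \<bullet> \<xi> \<tau> + r i \<bullet> \<mu> i \<tau> (\<xi> \<tau>)"

definition cost ::
  "real \<Rightarrow> (nat \<Rightarrow> rvec) \<Rightarrow> (nat \<Rightarrow> rvec) \<Rightarrow> (nat \<Rightarrow> feedback) \<Rightarrow> nat \<Rightarrow> real \<Rightarrow> (real \<Rightarrow> rvec) \<Rightarrow> real" where
  "cost T s r \<mu> i t \<xi> = integral {t..T} (running_cost s r \<mu> i \<xi>)"

(* A closed-loop solution does not force the input signal to be measurable (a non-measurable part
   may lie in the kernel of B i), and then the cost does not exist, while "integral" is 0. *)
definition cost_defined ::
  "real \<Rightarrow> (nat \<Rightarrow> rvec) \<Rightarrow> (nat \<Rightarrow> rvec) \<Rightarrow> (nat \<Rightarrow> feedback) \<Rightarrow> nat \<Rightarrow> real \<Rightarrow> (real \<Rightarrow> rvec) \<Rightarrow> bool" where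
  "cost_defined T s r \<mu> i t \<xi> \<longleftrightarrow> running_cost s r \<mu> i \<xi> integrable_on {t..T}"

definition feedback_nash_equilibrium ::
  "nat \<Rightarrow> nat \<Rightarrow> real \<Rightarrow> rmat \<Rightarrow> (nat \<Rightarrow> rmat) \<Rightarrow> (nat \<Rightarrow> rmat) \<Rightarrow> (nat \<Rightarrow> rvec) \<Rightarrow> (nat \<Rightarrow> rvec)
     \<Rightarrow> (nat \<Rightarrow> feedback) \<Rightarrow> bool" where
  "feedback_nash_equilibrium N n T A B E s r \<mu> \<longleftrightarrow>
     (\<forall>i<N. admissible_feedback n T (E i) (\<mu> i)) \<and>
     closed_loop_solvable N n T A B E \<mu> \<and>
     (\<forall>t\<in>{0..T}. \<forall>x\<in>nonneg_orthant n. \<forall>\<xi>. closed_loop_solution N n T A B E \<mu> t x \<xi> \<longrightarrow>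
        (\<forall>i<N. cost_defined T s r \<mu> i t \<xi>)) \<and>
     (\<forall>i<N. \<forall>\<nu>. admissible_feedback n T (E i) \<nu> \<and>
        closed_loop_solvable N n T A B E (\<mu>(i := \<nu>)) \<longrightarrow>
        (\<forall>t\<in>{0..T}. \<forall>x\<in>nonneg_orthant n. \<forall>\<xi> \<eta>.
           closed_loop_solution N n T A B E \<mu> t x \<xi> \<and>
           closed_loop_solution N n T A B E (\<mu>(i := \<nu>)) t x \<eta> \<and>
           cost_defined T s r (\<mu>(i := \<nu>)) i t \<eta> \<longrightarrow>
           cost T s r \<mu> i t \<xi> \<le> cost T s r (\<mu>(i := \<nu>)) i t \<eta>))"

end

theory Submission
  imports Defs
begin

text \<open>The value function of player i is linear, V(t,x) = p i t \<bullet> x. If the other players use their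
  sign feedbacks and player i applies an input u with \<bar>u\<bar> \<le> E i x, then along the trajectory
  V' = y \<bullet> (K i x) + y \<bullet> u - (running cost), where y = r i + (B i)^T p i. Since
  y \<bullet> (K i x) = \<bar>y\<bar> \<bullet> (E i x), the first two terms add up to at least 0, with
  equality for u = - K i x. As V is absolutely continuous along trajectories and V(T, _) = 0,
  integration gives cost \<ge> V(t,x), with equality at the equilibrium. The closed loop is solvable
  because its matrix is bounded, Metzler and, the switching functions being continuous and almost
  everywhere nonzero, continuous off a null set: after a diagonal shift that makes the matrix
  nonnegative, the Picard iterates increase to a nonnegative solution.\<close>

section \<open>Absolutely continuous functions\<close>

text \<open>Two obstacles shape the proof. A deviation is an arbitrary function of time and state,
  so the input along its trajectory need not be measurable. The fundamental theorem is therefore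
  proved with integrability as a conclusion and applied to the derivative of the value as a whole:
  there \<open>r i \<bullet> u\<close> cancels against the running cost and only
  \<open>p i t \<bullet> (B i *\<^sub>v u)\<close> remains of the input, so no single term has to be
  integrated by itself. The other obstacle is the existence of the equilibrium trajectory, since the
  closed-loop matrix jumps whenever a switching function changes sign, possibly infinitely often.
  Continuity of the matrix off a null set suffices twice: for the integrability of the Picard
  iterates, and for recovering the derivative from the integral equation at every time outside that
  set. Condition (1) is the worst case over all sign patterns, so the closed loop stays Metzler
  through all jumps. Zeros of a switching function do not disturb the cost estimates, because z * v
  = |z| holds for every v in the sign set at z. That they form a null set enters through
  existence.\<close>

definition short_intervals :: "real \<Rightarrow> real \<Rightarrow> real \<Rightarrow> 'i set \<Rightarrow> ('i \<Rightarrow> real) \<Rightarrow> ('i \<Rightarrow> real) \<Rightarrow> bool" where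
  "short_intervals a b d I l r \<longleftrightarrow>
     (\<forall>i\<in>I. a \<le> l i \<and> l i \<le> r i \<and> r i \<le> b) \<and>
     disjoint_family_on (\<lambda>i. {l i<..<r i}) I \<and> (\<Sum>i\<in>I. r i - l i) < d"

lemma abs_cont_on_iff_short_intervals:
  "abs_cont_on a b f \<longleftrightarrow> (\<forall>e>0. \<exists>d>0. \<forall>(q::nat) l r.
     short_intervals a b d {..<q} l r \<longrightarrow> (\<Sum>i<q. \<bar>f (r i) - f (l i)\<bar>) < e)"
  unfolding abs_cont_on_def short_intervals_def Ball_def lessThan_iff ..

lemma short_intervals_mono:
  assumes "short_intervals a' b' d' I l r" "a \<le> a'" "b' \<le> b" "d' \<le> d"
  shows "short_intervals a b d I l r"
  using assms by (fastforce simp: short_intervals_def)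

lemma abs_cont_onE:
  assumes "abs_cont_on a b f" "e > 0"
  obtains d where "d > 0" "\<And>(q::nat) l r.
    short_intervals a b d {..<q} l r \<Longrightarrow> (\<Sum>i<q. \<bar>f (r i) - f (l i)\<bar>) < e"
  using assms unfolding abs_cont_on_iff_short_intervals by blast

text \<open>A tagged division is a set of pairs (tag, interval), not an enumerated family, so the
  defining estimate is transported along a bijection with an initial segment of the
  naturals.\<close>

lemma abs_cont_on_finiteE:
  assumes "abs_cont_on a b f" "e > 0"
  obtains d where "d > 0" "\<And>(I :: 'i set) l r.
    \<lbrakk>finite I; short_intervals a b d I l r\<rbrakk> \<Longrightarrow> (\<Sum>i\<in>I. \<bar>f (r i) - f (l i)\<bar>) < e"
proof -
  obtain d where d: "d > 0" "\<And>(q::nat) l r.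
      short_intervals a b d {..<q} l r \<Longrightarrow> (\<Sum>i<q. \<bar>f (r i) - f (l i)\<bar>) < e"
    using abs_cont_onE[OF assms] by blast
  have "(\<Sum>i\<in>I. \<bar>f (r i) - f (l i)\<bar>) < e"
    if I: "finite I" and lr: "short_intervals a b d I l r" for I :: "'i set" and l r
  proof -
    obtain h where h: "bij_betw h {..<card I} I"
      using ex_bij_betw_nat_finite[OF I] by (auto simp: atLeast0LessThan)
    then have h': "inj_on h {..<card I}" "h ` {..<card I} = I"
      by (auto simp: bij_betw_def)
    have "(\<Sum>i<card I. \<bar>f (r (h i)) - f (l (h i))\<bar>) < e"
    proof (rule d(2), unfold short_intervals_def, intro conjI ballI)
      fix i assume "i \<in> {..<card I}"
      then have "h i \<in> I" using h' by blast
      then show "a \<le> l (h i)" "l (h i) \<le> r (h i)" "r (h i) \<le> b"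
        using lr by (auto simp: short_intervals_def)
    next
      show "disjoint_family_on (\<lambda>i. {l (h i)<..<r (h i)}) {..<card I}"
        unfolding disjoint_family_on_def
      proof (intro ballI impI)
        fix i j assume ij: "i \<in> {..<card I}" "j \<in> {..<card I}" "i \<noteq> j"
        then have "h i \<in> I" "h j \<in> I" "h i \<noteq> h j" using h' by (auto simp: inj_on_eq_iff)
        then show "{l (h i)<..<r (h i)} \<inter> {l (h j)<..<r (h j)} = {}"
          using lr by (simp add: short_intervals_def disjoint_family_on_def)
      qed
      show "(\<Sum>i<card I. r (h i) - l (h i)) < d"
        using lr sum.reindex_bij_betw[OF h, of "\<lambda>i. r i - l i"] by (simp add: short_intervals_def)
    qed
    then show ?thesis
      using sum.reindex_bij_betw[OF h, of "\<lambda>i. \<bar>f (r i) - f (l i)\<bar>"] by simp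
  qed
  then show thesis using d(1) that by blast
qed

section \<open>Fundamental theorem of calculus for absolutely continuous functions\<close>

lemma negligible_outer_open:
  fixes S :: "real set"
  assumes "negligible S" "d > 0"
  obtains U where "open U" "S \<subseteq> U" "U \<in> lmeasurable" "measure lebesgue U < d"
proof -
  have S: "S \<in> null_sets lebesgue"
    using assms(1) by (simp add: negligible_iff_null_sets)
  then obtain U where U: "open U" "S \<subseteq> U" "U - S \<in> lmeasurable"
      "emeasure lebesgue (U - S) < ennreal d"
    using sets_lebesgue_outer_open[of S d] assms(2) by auto
  have "measure lebesgue (U - S) < d"
    using U(3,4) assms(2) by (simp add: emeasure_eq_measure2 ennreal_less_iff)
  moreover have eq: "(U - S) \<union> S = U" using U(2) by blast
  moreover have "measure lebesgue ((U - S) \<union> S) = measure lebesgue (U - S)"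
    using U(3) S by (intro measure_Un_null_set) auto
  moreover have "(U - S) \<union> S \<in> lmeasurable"
    using U(3) S by (intro fmeasurable.Un) (auto intro: fmeasurableI_null_sets)
  ultimately show thesis
    using that[OF U(1,2)] by simp
qed

lemma sum_le_measure_of_disjoint_intervals:
  fixes l r :: "'i \<Rightarrow> real"
  assumes "finite I" "disjoint_family_on (\<lambda>i. {l i<..<r i}) I" "U \<in> lmeasurable"
    and "\<And>i. i \<in> I \<Longrightarrow> l i \<le> r i" "\<And>i. i \<in> I \<Longrightarrow> {l i<..<r i} \<subseteq> U"
  shows "(\<Sum>i\<in>I. r i - l i) \<le> measure lebesgue U"
proof -
  have "(\<Sum>i\<in>I. r i - l i) = (\<Sum>i\<in>I. measure lebesgue {l i<..<r i})"
    using assms(4) by (intro sum.cong) auto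
  also have "\<dots> = measure lebesgue (\<Union>i\<in>I. {l i<..<r i})"
    using assms(1,2,4) by (intro measure_finite_Union[symmetric]) auto
  also have "\<dots> \<le> measure lebesgue U"
    using assms by (intro measure_mono_fmeasurable) auto
  finally show ?thesis .
qed

text \<open>The Henstock-Kurzweil proof of the fundamental theorem of calculus, except that the tags in
  the exceptional null set are confined to an open set so small that absolute continuity controls
  the increments of f there.\<close>

theorem abs_cont_on_fundamental_theorem:
  fixes f h :: "real \<Rightarrow> real"
  assumes "a \<le> b" "abs_cont_on a b f" "negligible S"
    and der: "\<And>x. x \<in> {a..b} - S \<Longrightarrow> (f has_real_derivative h x) (at x within {a..b})"
  shows "(h has_integral (f b - f a)) {a..b}"
proof -
  \<comment> \<open>Nothing is known about \<open>h\<close> on \<open>S\<close>. With the value 0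
    there, a tag in \<open>S\<close> contributes only an increment of \<open>f\<close>; since
    \<open>S\<close> is negligible, the change is undone at the end.\<close>
  define g where "g = (\<lambda>x. if x \<in> S then 0 else h x)"
  have "(g has_integral (f b - f a)) {a..b}"
    unfolding has_integral_real
  proof (intro allI impI)
    fix e0 :: real assume "e0 > 0"
    \<comment> \<open>The tags outside \<open>S\<close> contribute at most e * (b - a), which this
      choice keeps below e0 / 2; the summand 1 covers a = b. The other half of e0 is left for the
      tags in \<open>S\<close>.\<close>
    define e where "e = e0 / (2 * (b - a + 1))"
    have e: "e > 0" using \<open>e0 > 0\<close> \<open>a \<le> b\<close> by (simp add: e_def)
    have "e * (b - a) < e0 / 2"
      using \<open>e0 > 0\<close> \<open>a \<le> b\<close> by (simp add: e_def field_simps)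
    have "\<forall>x. \<exists>d>0. x \<in> {a..b} - S \<longrightarrow>
         (\<forall>y\<in>{a..b}. norm (y-x) < d \<longrightarrow> norm (f y - f x - (y-x) *\<^sub>R h x) \<le> e * norm (y-x))"
      using der[unfolded has_real_derivative_iff_has_vector_derivative
          has_vector_derivative_def has_derivative_within_alt] e
      by (metis zero_less_one)
    then obtain d where d: "\<And>x. 0 < d x"
                 "\<And>x y. \<lbrakk>x \<in> {a..b} - S; y \<in> {a..b}; \<bar>y-x\<bar> < d x\<rbrakk>
                        \<Longrightarrow> \<bar>f y - f x - (y-x) * h x\<bar> \<le> e * \<bar>y-x\<bar>"
      unfolding real_norm_def real_scaleR_def by metis
    obtain c where c: "c > 0" "\<And>(I :: (real \<times> real set) set) l r.
        \<lbrakk>finite I; short_intervals a b c I l r\<rbrakk> \<Longrightarrow> (\<Sum>i\<in>I. \<bar>f (r i) - f (l i)\<bar>) < e0 / 2"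
      using abs_cont_on_finiteE[OF assms(2), of "e0/2"] \<open>e0 > 0\<close> by (metis half_gt_zero)
    obtain U where U: "open U" "S \<subseteq> U" "U \<in> lmeasurable" "measure lebesgue U < c"
      using negligible_outer_open[OF assms(3) c(1)] .
    define G where "G = (\<lambda>x. if x \<in> S then U else ball x (d x))"
    show "\<exists>\<gamma>. gauge \<gamma> \<and> (\<forall>D. D tagged_division_of {a..b} \<and> \<gamma> fine D \<longrightarrow>
            norm ((\<Sum>(x, k)\<in>D. Henstock_Kurzweil_Integration.content k *\<^sub>R g x) - (f b - f a)) < e0)"
    proof (intro exI[of _ G] conjI allI impI)
      show "gauge G"
        using U(1,2) d(1) by (auto simp: gauge_def G_def)
      fix D assume "D tagged_division_of {a..b} \<and> G fine D"
      then have D: "D tagged_division_of {a..b}" and fine: "G fine D" by auto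
      define I where "I = {xk \<in> D. fst xk \<in> S}"
      define l r where "l = (\<lambda>xk::real \<times> real set. Inf (snd xk))"
        and "r = (\<lambda>xk::real \<times> real set. Sup (snd xk))"
      have fD: "finite D" using D by auto
      then have fI: "finite I" by (simp add: I_def)
      have int: "k = {l (x,k)..r (x,k)} \<and> x \<in> k \<and> k \<subseteq> {a..b} \<and> l (x,k) \<le> r (x,k)
          \<and> k \<subseteq> G x" if xk: "(x,k) \<in> D" for x k
      proof -
        obtain u v where k: "k = {u..v}"
          using tagged_division_ofD(4)[OF D xk] by auto
        have "x \<in> k" "k \<subseteq> {a..b}" using tagged_division_ofD(2,3)[OF D xk] .
        moreover have "u \<le> v" using k \<open>x \<in> k\<close> by auto
        ultimately show ?thesis using k fine xk by (auto simp: l_def r_def fine_def)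
      qed
      have disj: "disjoint_family_on (\<lambda>i. {l i<..<r i}) D"
        unfolding disjoint_family_on_def
      proof (intro ballI impI)
        fix i j assume ij: "i \<in> D" "j \<in> D" "i \<noteq> j"
        obtain x k y k' where [simp]: "i = (x,k)" "j = (y,k')" by (cases i, cases j)
        have "interior k \<inter> interior k' = {}"
          using tagged_division_ofD(5)[OF D] ij by auto
        then show "{l i<..<r i} \<inter> {l j<..<r j} = {}"
          using int[of x k] int[of y k'] ij by (metis \<open>i = (x, k)\<close> \<open>j = (y, k')\<close> interior_atLeastAtMost_real)
      qed
      have "norm ((\<Sum>(x, k)\<in>D. Henstock_Kurzweil_Integration.content k *\<^sub>R g x) - (f b - f a))
          = \<bar>\<Sum>i\<in>D. (r i - l i) * g (fst i) - (f (r i) - f (l i))\<bar>"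
      proof -
        have "(\<Sum>(x, k)\<in>D. Henstock_Kurzweil_Integration.content k *\<^sub>R g x) = (\<Sum>i\<in>D. (r i - l i) * g (fst i))"
        proof (intro sum.cong refl, clarify)
          fix x k assume "(x,k) \<in> D"
          then have "Henstock_Kurzweil_Integration.content k = r (x,k) - l (x,k)" using int[of x k] by (metis content_real)
          then show "Henstock_Kurzweil_Integration.content k *\<^sub>R g x = (r (x, k) - l (x, k)) * g (fst (x, k))" by simp
        qed
        moreover have "f b - f a = (\<Sum>i\<in>D. f (r i) - f (l i))"
          using additive_tagged_division_1[OF assms(1) D, of f] by (simp add: case_prod_unfold l_def r_def)
        ultimately show ?thesis by (simp add: sum_subtractf)
      qed
      also have "\<dots> \<le> (\<Sum>i\<in>D. \<bar>(r i - l i) * g (fst i) - (f (r i) - f (l i))\<bar>)"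
        by (rule sum_abs)
      also have "\<dots> = (\<Sum>i\<in>I. \<bar>(r i - l i) * g (fst i) - (f (r i) - f (l i))\<bar>)
          + (\<Sum>i\<in>D-I. \<bar>(r i - l i) * g (fst i) - (f (r i) - f (l i))\<bar>)"
        using sum.subset_diff[OF _ fD, of I] by (simp add: I_def add.commute)
      also have "\<dots> < e0/2 + e0/2"
      proof (rule add_less_le_mono)
        have "(\<Sum>i\<in>I. \<bar>(r i - l i) * g (fst i) - (f (r i) - f (l i))\<bar>) = (\<Sum>i\<in>I. \<bar>f (r i) - f (l i)\<bar>)"
          by (intro sum.cong refl) (auto simp: I_def g_def)
        also have "\<dots> < e0/2"
        proof (rule c(2)[OF fI], unfold short_intervals_def, intro conjI)
          show "\<forall>i\<in>I. a \<le> l i \<and> l i \<le> r i \<and> r i \<le> b"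
          proof
            fix i assume "i \<in> I"
            obtain x k where [simp]: "i = (x,k)" by (cases i)
            have xk: "(x,k) \<in> D" using \<open>i \<in> I\<close> by (simp add: I_def)
            then have "{l (x,k)..r (x,k)} \<subseteq> {a..b}" "l (x,k) \<le> r (x,k)" using int[OF xk] by metis+
            then show "a \<le> l i \<and> l i \<le> r i \<and> r i \<le> b" by auto
          qed
          show dI: "disjoint_family_on (\<lambda>i. {l i<..<r i}) I"
            using disj by (rule disjoint_family_on_mono[rotated]) (auto simp: I_def)
          have "(\<Sum>i\<in>I. r i - l i) \<le> measure lebesgue U"
          proof (rule sum_le_measure_of_disjoint_intervals[OF fI dI U(3)])
            fix i assume "i \<in> I"
            obtain x k where [simp]: "i = (x,k)" by (cases i)
            have xk: "(x,k) \<in> D" "x \<in> S" using \<open>i \<in> I\<close> by (simp_all add: I_def)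
            then have "{l (x,k)..r (x,k)} \<subseteq> U" "l (x,k) \<le> r (x,k)"
              using int[OF xk(1)] by (metis G_def)+
            then show "l i \<le> r i" "{l i<..<r i} \<subseteq> U" by (auto simp: subset_iff)
          qed
          then show "(\<Sum>i\<in>I. r i - l i) < c" using U(4) by simp
        qed
        finally show "(\<Sum>i\<in>I. \<bar>(r i - l i) * g (fst i) - (f (r i) - f (l i))\<bar>) < e0/2" .
        have "(\<Sum>i\<in>D-I. \<bar>(r i - l i) * g (fst i) - (f (r i) - f (l i))\<bar>) \<le> (\<Sum>i\<in>D-I. e * (r i - l i))"
        proof (rule sum_mono)
          fix i assume i: "i \<in> D - I"
          obtain x k where [simp]: "i = (x,k)" by (cases i)
          have xk: "(x,k) \<in> D" "x \<notin> S" using i by (simp_all add: I_def)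
          note I = int[OF xk(1)]
          define u v where "u = l (x,k)" and "v = r (x,k)"
          have k: "k = {u..v}" "x \<in> k" "k \<subseteq> {a..b}" "k \<subseteq> ball x (d x)"
            using I xk(2) by (auto simp: u_def v_def G_def)
          then have uv: "u \<in> k" "v \<in> k" "u \<le> x" "x \<le> v" "x \<in> {a..b} - S" using xk(2) by auto
          have near: "\<bar>u-x\<bar> < d x" "\<bar>v-x\<bar> < d x"
            using subsetD[OF k(4) uv(1)] subsetD[OF k(4) uv(2)]
            by (auto simp: dist_real_def abs_minus_commute)
          have ab: "u \<in> {a..b}" "v \<in> {a..b}" using uv(1,2) k(3) by auto
          have "\<bar>f u - f x - (u-x) * h x\<bar> \<le> e * \<bar>u-x\<bar>"
            by (rule d(2)[OF uv(5) ab(1) near(1)])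
          moreover have "\<bar>f v - f x - (v-x) * h x\<bar> \<le> e * \<bar>v-x\<bar>"
            by (rule d(2)[OF uv(5) ab(2) near(2)])
          \<comment> \<open>The tag lies between the endpoints, so the two errors carry the weights
            x - u and v - x, which add up to the length v - u.\<close>
          ultimately have "\<bar>f u - f x - (u-x) * h x\<bar> + \<bar>f v - f x - (v-x) * h x\<bar> \<le> e * (x - u) + e * (v - x)"
            using uv by simp
          moreover have "(v - u) * h x - (f v - f u) = (f u - f x - (u-x) * h x) - (f v - f x - (v-x) * h x)"
            by (simp add: algebra_simps)
          ultimately have "\<bar>(v - u) * h x - (f v - f u)\<bar> \<le> e * (v - u)"
            by (simp add: algebra_simps)
          then show "\<bar>(r i - l i) * g (fst i) - (f (r i) - f (l i))\<bar> \<le> e * (r i - l i)"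
            using xk(2) by (simp add: g_def u_def v_def)
        qed
        also have "\<dots> \<le> (\<Sum>i\<in>D. e * (r i - l i))"
        proof (rule sum_mono2[OF fD])
          show "0 \<le> e * (r i - l i)" if "i \<in> D - (D - I)" for i
            using int[of "fst i" "snd i"] that e by simp
        qed auto
        also have "\<dots> = e * (b - a)"
          using additive_tagged_division_1[OF assms(1) D, of "\<lambda>x. x"]
          by (simp add: case_prod_unfold l_def r_def flip: sum_distrib_left)
        also have "\<dots> \<le> e0/2" using \<open>e * (b - a) < e0 / 2\<close> by simp
        finally show "(\<Sum>i\<in>D-I. \<bar>(r i - l i) * g (fst i) - (f (r i) - f (l i))\<bar>) \<le> e0/2" .
      qed
      finally show "norm ((\<Sum>(x, k)\<in>D. Henstock_Kurzweil_Integration.content k *\<^sub>R g x) - (f b - f a)) < e0" by simp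
    qed
  qed
  then show ?thesis
    by (rule has_integral_spike[OF assms(3), rotated]) (simp add: g_def)
qed

section \<open>Criteria and closure properties for absolute continuity\<close>

lemma abs_cont_on_lipschitz:
  assumes "\<And>x y. \<lbrakk>a \<le> x; x \<le> y; y \<le> b\<rbrakk> \<Longrightarrow> \<bar>f y - f x\<bar> \<le> L * (y - x)"
  shows "abs_cont_on a b f"
  unfolding abs_cont_on_iff_short_intervals
proof (intro allI impI)
  fix e :: real assume "e > 0"
  \<comment> \<open>Dividing by |L| + 1 instead of L keeps the threshold positive for every real L,
    including 0.\<close>
  have "(\<Sum>i<q. \<bar>f (r i) - f (l i)\<bar>) < e"
    if lr: "short_intervals a b (e / (\<bar>L\<bar> + 1)) {..<q} l r" for q :: nat and l r
  proof -
    have "(\<Sum>i<q. \<bar>f (r i) - f (l i)\<bar>) \<le> (\<Sum>i<q. (\<bar>L\<bar> + 1) * (r i - l i))"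
    proof (rule sum_mono)
      fix i assume "i \<in> {..<q}"
      then have i: "a \<le> l i" "l i \<le> r i" "r i \<le> b" using lr by (auto simp: short_intervals_def)
      have "L * (r i - l i) \<le> (\<bar>L\<bar> + 1) * (r i - l i)" using i by (intro mult_right_mono) auto
      then show "\<bar>f (r i) - f (l i)\<bar> \<le> (\<bar>L\<bar> + 1) * (r i - l i)" using assms[OF i] by linarith
    qed
    also have "\<dots> = (\<bar>L\<bar> + 1) * (\<Sum>i<q. r i - l i)" by (simp add: sum_distrib_left)
    also have "\<dots> < e" using lr by (simp add: short_intervals_def pos_less_divide_eq mult.commute)
    finally show ?thesis .
  qed
  moreover have "0 < e / (\<bar>L\<bar> + 1)" using \<open>e > 0\<close> by simp
  ultimately show "\<exists>d>0. \<forall>(q::nat) l r.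
      short_intervals a b d {..<q} l r \<longrightarrow> (\<Sum>i<q. \<bar>f (r i) - f (l i)\<bar>) < e" by blast
qed

lemma abs_cont_on_subinterval:
  assumes "abs_cont_on a b f" "a \<le> a'" "b' \<le> b"
  shows "abs_cont_on a' b' f"
  using assms short_intervals_mono[OF _ assms(2,3) order_refl]
  unfolding abs_cont_on_iff_short_intervals by meson

lemma abs_cont_on_imp_continuous_on:
  assumes "abs_cont_on a b f"
  shows "continuous_on {a..b} f"
  unfolding continuous_on_iff
proof (intro ballI allI impI)
  fix x e :: real assume x: "x \<in> {a..b}" and "e > 0"
  obtain d where d: "d > 0" "\<And>(q::nat) l r.
      short_intervals a b d {..<q} l r \<Longrightarrow> (\<Sum>i<q. \<bar>f (r i) - f (l i)\<bar>) < e"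
    using abs_cont_onE[OF assms \<open>e > 0\<close>] by blast
  have one: "\<bar>f v - f u\<bar> < e" if "a \<le> u" "u \<le> v" "v \<le> b" "v - u < d" for u v
    using d(2)[of 1 "\<lambda>_. u" "\<lambda>_. v"] that
    by (simp add: disjoint_family_on_def short_intervals_def)
  show "\<exists>d>0. \<forall>x'\<in>{a..b}. dist x' x < d \<longrightarrow> dist (f x') (f x) < e"
  proof (intro exI[of _ d] conjI d(1) ballI impI)
    fix y assume "y \<in> {a..b}" "dist y x < d"
    then show "dist (f y) (f x) < e"
      using one[of x y] one[of y x] x by (cases "x \<le> y") (auto simp: dist_real_def abs_minus_commute)
  qed
qed

text \<open>Common source of the closure under sums and products: increments of a sum are dominated
  with constants 1, those of a product with the bounds of the opposite factors, which exist by
  compactness.\<close>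

lemma abs_cont_on_dominated:
  assumes "abs_cont_on a b f" "abs_cont_on a b g" "F > 0" "G > 0"
    and le: "\<And>x y. \<lbrakk>x \<in> {a..b}; y \<in> {a..b}\<rbrakk> \<Longrightarrow> \<bar>h y - h x\<bar> \<le> F * \<bar>f y - f x\<bar> + G * \<bar>g y - g x\<bar>"
  shows "abs_cont_on a b h"
  unfolding abs_cont_on_iff_short_intervals
proof (intro allI impI)
  fix e :: real assume "e > 0"
  then have pos: "e / (2 * F) > 0" "e / (2 * G) > 0" using assms(3,4) by auto
  obtain d1 where d1: "d1 > 0" "\<And>(q::nat) l r.
      short_intervals a b d1 {..<q} l r \<Longrightarrow> (\<Sum>i<q. \<bar>f (r i) - f (l i)\<bar>) < e / (2 * F)"
    using abs_cont_onE[OF assms(1) pos(1)] by blast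
  obtain d2 where d2: "d2 > 0" "\<And>(q::nat) l r.
      short_intervals a b d2 {..<q} l r \<Longrightarrow> (\<Sum>i<q. \<bar>g (r i) - g (l i)\<bar>) < e / (2 * G)"
    using abs_cont_onE[OF assms(2) pos(2)] by blast
  have "(\<Sum>i<q. \<bar>h (r i) - h (l i)\<bar>) < e"
    if lr: "short_intervals a b (min d1 d2) {..<q} l r" for q :: nat and l r
  proof -
    have 1: "(\<Sum>i<q. \<bar>f (r i) - f (l i)\<bar>) < e / (2 * F)"
      by (rule d1(2)[OF short_intervals_mono[OF lr]]) auto
    have 2: "(\<Sum>i<q. \<bar>g (r i) - g (l i)\<bar>) < e / (2 * G)"
      by (rule d2(2)[OF short_intervals_mono[OF lr]]) auto
    have "(\<Sum>i<q. \<bar>h (r i) - h (l i)\<bar>)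
        \<le> (\<Sum>i<q. F * \<bar>f (r i) - f (l i)\<bar> + G * \<bar>g (r i) - g (l i)\<bar>)"
      using lr by (intro sum_mono le) (force simp: short_intervals_def)+
    also have "\<dots> = F * (\<Sum>i<q. \<bar>f (r i) - f (l i)\<bar>) + G * (\<Sum>i<q. \<bar>g (r i) - g (l i)\<bar>)"
      by (simp add: sum.distrib sum_distrib_left)
    also have "\<dots> < F * (e / (2 * F)) + G * (e / (2 * G))"
      using 1 2 assms(3,4) by (intro add_strict_mono mult_strict_left_mono)
    also have "\<dots> = e" using assms(3,4) by simp
    finally show ?thesis .
  qed
  moreover have "min d1 d2 > 0" using d1 d2 by simp
  ultimately show "\<exists>d>0. \<forall>(q::nat) l r.
      short_intervals a b d {..<q} l r \<longrightarrow> (\<Sum>i<q. \<bar>h (r i) - h (l i)\<bar>) < e" by blast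
qed

lemma abs_cont_on_add:
  assumes "abs_cont_on a b f" "abs_cont_on a b g"
  shows "abs_cont_on a b (\<lambda>x. f x + g x)"
  by (rule abs_cont_on_dominated[OF assms, of 1 1]) auto

lemma abs_cont_on_mult:
  assumes "abs_cont_on a b f" "abs_cont_on a b g"
  shows "abs_cont_on a b (\<lambda>x. f x * g x)"
proof -
  have "\<exists>M>0. \<forall>x\<in>{a..b}. \<bar>h x\<bar> \<le> M" if h: "abs_cont_on a b h" for h
  proof -
    have "bounded (h ` {a..b})"
      by (intro compact_imp_bounded compact_continuous_image abs_cont_on_imp_continuous_on h) auto
    then show ?thesis by (auto simp: bounded_pos)
  qed
  then obtain F G where F: "F > 0" "\<And>x. x \<in> {a..b} \<Longrightarrow> \<bar>f x\<bar> \<le> F"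
    and G: "G > 0" "\<And>x. x \<in> {a..b} \<Longrightarrow> \<bar>g x\<bar> \<le> G"
    using assms by metis
  show ?thesis
  proof (rule abs_cont_on_dominated[OF assms G(1) F(1)])
    fix x y assume xy: "x \<in> {a..b}" "y \<in> {a..b}"
    have "\<bar>f y * g y - f x * g x\<bar> = \<bar>g y * (f y - f x) + f x * (g y - g x)\<bar>"
      by (simp add: algebra_simps)
    also have "\<dots> \<le> \<bar>g y\<bar> * \<bar>f y - f x\<bar> + \<bar>f x\<bar> * \<bar>g y - g x\<bar>"
      by (metis abs_mult abs_triangle_ineq)
    also have "\<dots> \<le> G * \<bar>f y - f x\<bar> + F * \<bar>g y - g x\<bar>"
      using F(2) G(2) xy by (intro add_mono mult_right_mono) auto
    finally show "\<bar>f y * g y - f x * g x\<bar> \<le> G * \<bar>f y - f x\<bar> + F * \<bar>g y - g x\<bar>" .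
  qed
qed

lemma abs_cont_on_sum:
  assumes "\<And>k. k \<in> I \<Longrightarrow> abs_cont_on a b (f k)"
  shows "abs_cont_on a b (\<lambda>x. \<Sum>k\<in>I. f k x)"
  using assms
proof (induction I rule: infinite_finite_induct)
  case (insert k I)
  then show ?case by (simp add: abs_cont_on_add)
qed (auto intro: abs_cont_on_lipschitz[of _ _ _ 0])

section \<open>Linear systems with a Metzler matrix\<close>

text \<open>Continuity of the restriction gives measurability on the complement of \<open>Z\<close>,
  the constant dominates there, and a null set does not affect the integral.\<close>

lemma integrable_on_bounded_continuous_off_negligible:
  fixes f :: "real \<Rightarrow> real"
  assumes "negligible Z" "continuous_on ({a..b} - Z) f" "\<And>x. x \<in> {a..b} \<Longrightarrow> \<bar>f x\<bar> \<le> C"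
  shows "f integrable_on {a..b}"
proof -
  have S: "{a..b} - Z \<in> sets lebesgue"
    using assms(1) by (intro sets.Diff) (auto simp: negligible_iff_null_sets)
  have spike: "g integrable_on {a..b} - Z \<longleftrightarrow> g integrable_on {a..b}" for g :: "real \<Rightarrow> real"
    by (rule integrable_spike_set_eq, rule negligible_subset[OF assms(1)]) auto
  have "f integrable_on {a..b} - Z"
  proof (rule measurable_bounded_by_integrable_imp_integrable)
    show "f \<in> borel_measurable (lebesgue_on ({a..b} - Z))"
      using assms(2) S by (rule continuous_imp_measurable_on_sets_lebesgue)
    show "(\<lambda>x. C) integrable_on {a..b} - Z" by (simp add: spike integrable_const_ivl)
    show "norm (f x) \<le> C" if "x \<in> {a..b} - Z" for x using assms(3) that by auto
  qed (use S in auto)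
  then show ?thesis by (simp add: spike)
qed

text \<open>The system y' = P y that remains after the diagonal shift. Outside \<open>Z\<close>
  continuity is asked within the whole interval, not merely for the restriction to the complement of
  \<open>Z\<close>: differentiating an integral at such a point takes the stronger form.\<close>

locale nonneg_linear_system =
  fixes n :: nat and P :: "nat \<Rightarrow> nat \<Rightarrow> real \<Rightarrow> real" and a b D :: real and Z :: "real set"
    and x :: "nat \<Rightarrow> real"
  assumes ab: "a \<le> b" and Z: "negligible Z"
    and P_nonneg: "\<And>i j t. \<lbrakk>i < n; j < n; t \<in> {a..b}\<rbrakk> \<Longrightarrow> 0 \<le> P i j t"
    and P_le: "\<And>i j t. \<lbrakk>i < n; j < n; t \<in> {a..b}\<rbrakk> \<Longrightarrow> P i j t \<le> D"
    and P_cont: "\<And>i j t. \<lbrakk>i < n; j < n; t \<in> {a..b} - Z\<rbrakk> \<Longrightarrow> continuous (at t within {a..b}) (P i j)"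
    and x_nonneg: "\<And>i. i < n \<Longrightarrow> 0 \<le> x i"
    and D: "0 \<le> D"
begin

section \<open>Picard iterates and their common majorant\<close>

definition rhs :: "(nat \<Rightarrow> real \<Rightarrow> real) \<Rightarrow> nat \<Rightarrow> real \<Rightarrow> real" where
  "rhs y i t = (\<Sum>j<n. P i j t * y j t)"

primrec picard :: "nat \<Rightarrow> nat \<Rightarrow> real \<Rightarrow> real" where
  "picard 0 = (\<lambda>i t. x i)"
| "picard (Suc k) = (\<lambda>i t. x i + integral {a..t} (rhs (picard k) i))"

text \<open>The solution of the scalar equation g' = n * D * g that starts at the sum of all initial
  values. A row has n entries of size at most D, so this one function dominates every component and
  is preserved as a bound by the Picard map.\<close>

definition growth :: "real \<Rightarrow> real" where
  "growth t = (\<Sum>i<n. x i) * exp (n * D * (t - a))"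

lemma growth_mono: "s \<le> t \<Longrightarrow> growth s \<le> growth t"
  using x_nonneg D by (auto simp: growth_def intro!: mult_left_mono sum_nonneg)

lemma rhs_le:
  assumes "i < n" "t \<in> {a..b}" "\<And>j. j < n \<Longrightarrow> 0 \<le> y j t \<and> y j t \<le> C"
  shows "0 \<le> rhs y i t" "rhs y i t \<le> n * D * C"
proof -
  show "0 \<le> rhs y i t"
    using assms P_nonneg by (auto simp: rhs_def intro!: sum_nonneg)
  have "rhs y i t \<le> (\<Sum>j<n. D * C)"
    unfolding rhs_def using assms P_nonneg P_le D by (intro sum_mono mult_mono) auto
  then show "rhs y i t \<le> n * D * C" by simp
qed

lemma rhs_continuous:
  assumes "\<And>j. j < n \<Longrightarrow> continuous_on {a..b} (y j)" "i < n" "t \<in> {a..b} - Z"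
  shows "continuous (at t within {a..b}) (rhs y i)"
proof -
  have "continuous (at t within {a..b}) (\<lambda>t. \<Sum>j<n. P i j t * y j t)"
    using assms P_cont[OF assms(2) _ assms(3)]
    by (intro continuous_intros) (auto simp: continuous_on_eq_continuous_within)
  then show ?thesis by (simp add: rhs_def[abs_def])
qed

lemma rhs_integrable:
  assumes "\<And>j. j < n \<Longrightarrow> continuous_on {a..b} (y j)" "i < n"
    and "\<And>j t. \<lbrakk>j < n; t \<in> {a..b}\<rbrakk> \<Longrightarrow> 0 \<le> y j t \<and> y j t \<le> C"
    and "{u..v} \<subseteq> {a..b}"
  shows "rhs y i integrable_on {u..v}"
proof -
  have "rhs y i integrable_on {a..b}"
  proof (rule integrable_on_bounded_continuous_off_negligible[OF Z])
    show "continuous_on ({a..b} - Z) (rhs y i)"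
      unfolding continuous_on_eq_continuous_within
    proof
      fix t assume t: "t \<in> {a..b} - Z"
      show "continuous (at t within {a..b} - Z) (rhs y i)"
        by (rule continuous_within_subset[OF rhs_continuous[OF assms(1,2) t]]) auto
    qed
    show "\<bar>rhs y i t\<bar> \<le> n * D * C" if "t \<in> {a..b}" for t
      using rhs_le[OF assms(2) that, of y C] assms(3) that by auto
  qed
  then show ?thesis using assms(4) by (rule integrable_on_subinterval)
qed

lemma growth_integral:
  assumes "t \<in> {a..b}"
  shows "((\<lambda>s. n * D * growth s) has_integral growth t - (\<Sum>i<n. x i)) {a..t}"
proof -
  have "((\<lambda>s. n * D * growth s) has_integral growth t - growth a) {a..t}"
  proof (rule fundamental_theorem_of_calculus)
    fix s
    show "(growth has_vector_derivative n * D * growth s) (at s within {a..t})"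
      unfolding growth_def[abs_def] has_real_derivative_iff_has_vector_derivative[symmetric]
      by (auto intro!: derivative_eq_intros simp: mult_ac)
  qed (use assms in auto)
  then show ?thesis by (simp add: growth_def)
qed

text \<open>The bound reproduces itself: the integral of n * D * growth is growth minus the sum of
  the \<open>x i\<close>, and \<open>x i\<close> is at most that sum. Continuity travels in the same
  induction because the next integrand has to be integrable.\<close>

lemma picard_continuous_bounded:
  "\<forall>i<n. continuous_on {a..b} (picard k i) \<and> (\<forall>t\<in>{a..b}. 0 \<le> picard k i t \<and> picard k i t \<le> growth t)"
proof (induction k)
  case 0
  have "x i \<le> growth t" if "i < n" "t \<in> {a..b}" for i t
  proof -
    have "x i \<le> (\<Sum>i<n. x i)" using x_nonneg that by (intro member_le_sum) auto
    also have "\<dots> = growth a" by (simp add: growth_def)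
    also have "\<dots> \<le> growth t" using that by (intro growth_mono) auto
    finally show ?thesis .
  qed
  then show ?case using x_nonneg by auto
next
  case (Suc k)
  have bnd: "0 \<le> picard k j t \<and> picard k j t \<le> growth b" if "j < n" "t \<in> {a..b}" for j t
    using Suc.IH that growth_mono[of t b] by force
  have int: "rhs (picard k) i integrable_on {u..v}" if "i < n" "{u..v} \<subseteq> {a..b}" for i u v
    using rhs_integrable[of "picard k" i "growth b" u v] Suc.IH bnd that by auto
  show ?case
  proof (intro allI impI conjI ballI)
    fix i assume i: "i < n"
    show "continuous_on {a..b} (picard (Suc k) i)"
      unfolding picard.simps
      using int[OF i] by (intro continuous_intros indefinite_integral_continuous_1) auto
    fix t assume t: "t \<in> {a..b}"
    have "0 \<le> integral {a..t} (rhs (picard k) i)"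
    proof (rule integral_nonneg[OF int[OF i]])
      fix s assume "s \<in> {a..t}"
      then show "0 \<le> rhs (picard k) i s"
        using t bnd by (intro rhs_le(1)[OF i, of _ _ "growth b"]) auto
    qed (use t in auto)
    then show "0 \<le> picard (Suc k) i t" using x_nonneg[OF i] by simp
    have "integral {a..t} (rhs (picard k) i) \<le> growth t - (\<Sum>i<n. x i)"
    proof (rule has_integral_le[OF integrable_integral growth_integral[OF t]])
      show "rhs (picard k) i integrable_on {a..t}" using int[OF i] t by auto
      fix s assume "s \<in> {a..t}"
      then show "rhs (picard k) i s \<le> n * D * growth s"
        using Suc.IH t by (intro rhs_le(2)[OF i]) auto
    qed
    moreover have "x i \<le> (\<Sum>i<n. x i)" using x_nonneg i by (intro member_le_sum) auto
    ultimately show "picard (Suc k) i t \<le> growth t" by simp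
  qed
qed

lemma picard_bounded:
  assumes "i < n" "t \<in> {a..b}"
  shows "0 \<le> picard k i t \<and> picard k i t \<le> growth b"
  using picard_continuous_bounded[of k] assms growth_mono[of t b] by force

lemma picard_integrable:
  assumes "i < n" "{u..v} \<subseteq> {a..b}"
  shows "rhs (picard k) i integrable_on {u..v}"
  using rhs_integrable[of "picard k" i "growth b" u v] picard_continuous_bounded[of k]
    picard_bounded assms by auto

text \<open>Nonnegative coefficients make the Picard map monotone, so it suffices that the first
  step goes up; it does, as it adds the integral of a nonnegative function to a constant. This is
  where the diagonal shift pays off: monotone convergence replaces a contraction estimate.\<close>

lemma picard_mono: "\<forall>i<n. \<forall>t\<in>{a..b}. picard k i t \<le> picard (Suc k) i t"
proof (induction k)
  case 0
  show ?case
  proof (intro allI impI ballI)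
    fix i t assume i: "i < n" and t: "t \<in> {a..b}"
    have "0 \<le> integral {a..t} (rhs (picard 0) i)"
    proof (rule integral_nonneg[OF picard_integrable[OF i]])
      fix s assume "s \<in> {a..t}"
      then show "0 \<le> rhs (picard 0) i s"
        using picard_bounded[of _ s 0] t by (intro rhs_le(1)[OF i, of _ _ "growth b"]) auto
    qed (use t in auto)
    then show "picard 0 i t \<le> picard (Suc 0) i t" by simp
  qed
next
  case (Suc k)
  show ?case
  proof (intro allI impI ballI)
    fix i t assume i: "i < n" and t: "t \<in> {a..b}"
    have sub: "{a..t} \<subseteq> {a..b}" using t by auto
    have "integral {a..t} (rhs (picard k) i) \<le> integral {a..t} (rhs (picard (Suc k)) i)"
    proof (rule integral_le[OF picard_integrable[OF i sub] picard_integrable[OF i sub]])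
      fix s assume "s \<in> {a..t}"
      then have "s \<in> {a..b}" using sub by blast
      then show "rhs (picard k) i s \<le> rhs (picard (Suc k)) i s"
        unfolding rhs_def using P_nonneg i Suc.IH by (intro sum_mono mult_left_mono) auto
    qed
    then show "picard (Suc k) i t \<le> picard (Suc (Suc k)) i t" by simp
  qed
qed

section \<open>The limit of the iterates solves the system\<close>

definition flow :: "nat \<Rightarrow> real \<Rightarrow> real" where
  "flow i t = lim (\<lambda>k. picard k i t)"

text \<open>Increasing and bounded above by \<open>growth b\<close>. Only for these \<open>i\<close>
  and \<open>t\<close> does \<open>lim\<close> in the definition of \<open>flow\<close> carry
  information.\<close>

lemma picard_tendsto_flow:
  assumes "i < n" "t \<in> {a..b}"
  shows "(\<lambda>k. picard k i t) \<longlonglongrightarrow> flow i t"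
proof -
  have "incseq (\<lambda>k. picard k i t)"
    using picard_mono assms by (intro incseq_SucI) auto
  then have "convergent (\<lambda>k. picard k i t)"
    using picard_bounded[OF assms] by (metis convergentI incseq_convergent)
  then show ?thesis by (simp add: flow_def convergent_LIMSEQ_iff)
qed

lemma flow_bounded:
  assumes "i < n" "t \<in> {a..b}"
  shows "0 \<le> flow i t \<and> flow i t \<le> growth b"
  using picard_bounded[OF assms] LIMSEQ_le_const[OF picard_tendsto_flow[OF assms]]
    LIMSEQ_le_const2[OF picard_tendsto_flow[OF assms]] by blast

text \<open>Passage to the limit in the recursion: the integrands converge pointwise and are bounded
  by the constant n * D * growth b, so dominated convergence applies.\<close>

lemma flow_integral:
  assumes i: "i < n" and t: "t \<in> {a..b}"
  shows "rhs flow i integrable_on {a..t}" "flow i t = x i + integral {a..t} (rhs flow i)"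
proof -
  have sub: "s \<in> {a..t} \<Longrightarrow> s \<in> {a..b}" for s using t by auto
  have lim: "(\<lambda>k. rhs (picard k) i s) \<longlonglongrightarrow> rhs flow i s" if "s \<in> {a..t}" for s
    unfolding rhs_def using picard_tendsto_flow sub[OF that] by (intro tendsto_intros) auto
  have dom: "norm (rhs (picard k) i s) \<le> n * D * growth b" if "s \<in> {a..t}" for k s
    using rhs_le[OF i sub[OF that], of "picard k" "growth b"] picard_bounded sub[OF that] by auto
  have int: "rhs (picard k) i integrable_on {a..t}" for k
    using picard_integrable[OF i] sub by blast
  have dc: "rhs flow i integrable_on {a..t}"
    "(\<lambda>k. integral {a..t} (rhs (picard k) i)) \<longlonglongrightarrow> integral {a..t} (rhs flow i)"
    using dominated_convergence[of "\<lambda>k. rhs (picard k) i" "{a..t}" "\<lambda>_. n * D * growth b" "rhs flow i"]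
      int dom lim by (auto simp: integrable_const_ivl)
  show "rhs flow i integrable_on {a..t}" by (rule dc(1))
  have "(\<lambda>k. picard (Suc k) i t) \<longlonglongrightarrow> x i + integral {a..t} (rhs flow i)"
    unfolding picard.simps by (intro tendsto_intros dc(2))
  moreover have "(\<lambda>k. picard (Suc k) i t) \<longlonglongrightarrow> flow i t"
    using picard_tendsto_flow[OF i t] by (rule LIMSEQ_Suc)
  ultimately show "flow i t = x i + integral {a..t} (rhs flow i)"
    using LIMSEQ_unique by blast
qed

lemma flow_start: "i < n \<Longrightarrow> flow i a = x i"
  using flow_integral(2)[of i a] ab by simp

text \<open>The increment is the integral of a function bounded by that constant. Absolute
  continuity of the flow follows from this Lipschitz bound alone.\<close>

lemma flow_lipschitz:
  assumes i: "i < n" and uv: "a \<le> u" "u \<le> v" "v \<le> b"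
  shows "\<bar>flow i v - flow i u\<bar> \<le> n * D * growth b * (v - u)"
proof -
  have int: "rhs flow i integrable_on {a..v}" using flow_integral(1)[OF i, of v] uv by auto
  have "flow i v - flow i u = integral {u..v} (rhs flow i)"
    using flow_integral(2)[OF i, of v] flow_integral(2)[OF i, of u] uv
      Henstock_Kurzweil_Integration.integral_combine[OF uv(1,2) int] by auto
  moreover have "norm (integral {u..v} (rhs flow i)) \<le> integral {u..v} (\<lambda>_. n * D * growth b)"
  proof (rule integral_norm_bound_integral)
    show "rhs flow i integrable_on {u..v}" using integrable_on_subinterval[OF int] uv by auto
    fix t assume "t \<in> {u..v}"
    then have t: "t \<in> {a..b}" using uv by auto
    show "norm (rhs flow i t) \<le> n * D * growth b"
      using rhs_le[OF i t, of flow "growth b"] flow_bounded t by auto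
  qed (simp add: integrable_const_ivl)
  moreover have "integral {u..v} (\<lambda>_. n * D * growth b) = n * D * growth b * (v - u)"
    using uv by simp
  ultimately show ?thesis by (metis real_norm_def)
qed

lemma flow_abs_cont: "i < n \<Longrightarrow> abs_cont_on a b (flow i)"
  using flow_lipschitz by (rule abs_cont_on_lipschitz)

text \<open>The flow is continuous and the coefficients are continuous at times outside
  \<open>Z\<close>, hence so is the integrand; the classical derivative of an integral at a point of
  continuity is enough.\<close>

lemma flow_deriv:
  assumes i: "i < n" and t: "t \<in> {a..b} - Z"
  shows "(flow i has_real_derivative rhs flow i t) (at t within {a..b})"
proof -
  have "continuous (at t within {a..b}) (rhs flow i)"
    using abs_cont_on_imp_continuous_on flow_abs_cont i t by (intro rhs_continuous) auto
  then have "((\<lambda>u. integral {a..u} (rhs flow i)) has_real_derivative rhs flow i t) (at t within {a..b})"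
    using integral_has_vector_derivative_continuous_at[of "rhs flow i" a b t "{}"]
      flow_integral(1)[OF i, of b] ab t
    by (simp add: has_real_derivative_iff_has_vector_derivative)
  then have "((\<lambda>u. x i + integral {a..u} (rhs flow i)) has_real_derivative rhs flow i t) (at t within {a..b})"
    by (auto intro!: derivative_eq_intros)
  then show ?thesis
    by (rule has_field_derivative_transform_within[where d = 1])
      (use t flow_integral(2)[OF i] in auto)
qed

end

lemma abs_cont_on_exp_decay:
  assumes "0 \<le> c"
  shows "abs_cont_on a b (\<lambda>t. exp (- c * (t - a)))"
proof (rule abs_cont_on_lipschitz)
  fix u v :: real assume uv: "a \<le> u" "u \<le> v" "v \<le> b"
  have eq: "exp (- c * (v - a)) = exp (- c * (u - a)) * exp (- c * (v - u))"
    by (simp add: exp_add[symmetric] algebra_simps)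
  have le: "exp (- c * (u - a)) \<le> 1" "exp (- c * (v - u)) \<le> 1" using assms uv by (auto simp: mult_nonneg_nonneg)
  have "\<bar>exp (- c * (v - a)) - exp (- c * (u - a))\<bar> = exp (- c * (u - a)) * (1 - exp (- c * (v - u)))"
    using le(2) unfolding eq by (simp add: abs_if algebra_simps)
  also have "\<dots> \<le> 1 * (1 - exp (- c * (v - u)))"
    using le by (intro mult_right_mono) auto
  also have "\<dots> \<le> c * (v - u)"
    using exp_ge_add_one_self[of "- c * (v - u)"] by simp
  finally show "\<bar>exp (- c * (v - a)) - exp (- c * (u - a))\<bar> \<le> c * (v - u)" .
qed

text \<open>Shifting the coefficients by c on the diagonal makes them nonnegative, so that the Picard
  iterates increase; the factor exp (- c * (t - a)) undoes the shift.\<close>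

lemma metzler_system_solution:
  fixes M :: "nat \<Rightarrow> nat \<Rightarrow> real \<Rightarrow> real"
  assumes "a \<le> b" "negligible Z"
    and M_bound: "\<And>i j t. \<lbrakk>i < n; j < n; t \<in> {a..b}\<rbrakk> \<Longrightarrow> \<bar>M i j t\<bar> \<le> C"
    and M_metzler: "\<And>i j t. \<lbrakk>i < n; j < n; i \<noteq> j; t \<in> {a..b}\<rbrakk> \<Longrightarrow> 0 \<le> M i j t"
    and M_cont: "\<And>i j t. \<lbrakk>i < n; j < n; t \<in> {a..b} - Z\<rbrakk> \<Longrightarrow> continuous (at t within {a..b}) (M i j)"
    and x: "\<And>i. i < n \<Longrightarrow> 0 \<le> x i"
  obtains y where "\<And>i. i < n \<Longrightarrow> y i a = x i"
    "\<And>i. i < n \<Longrightarrow> abs_cont_on a b (y i)"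
    "\<And>i t. \<lbrakk>i < n; t \<in> {a..b}\<rbrakk> \<Longrightarrow> 0 \<le> y i t"
    "\<And>i t. \<lbrakk>i < n; t \<in> {a..b} - Z\<rbrakk> \<Longrightarrow>
       (y i has_real_derivative (\<Sum>j<n. M i j t * y j t)) (at t within {a..b})"
proof -
  \<comment> \<open>For n = 0 the bound on \<open>M\<close> is vacuous and \<open>C\<close> may be
    negative; the absolute value keeps the shift, and with it the bound 2 * c on the shifted
    entries, nonnegative.\<close>
  define c where "c = \<bar>C\<bar>"
  define P where "P = (\<lambda>i j t. M i j t + (if i = j then c else 0))"
  interpret nonneg_linear_system n P a b "2 * c" Z x
  proof
    fix i j t assume ij: "i < n" "j < n"
    { assume t: "t \<in> {a..b}"
      show "0 \<le> P i j t" using M_bound[OF ij t] M_metzler[OF ij _ t] by (auto simp: P_def c_def)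
      show "P i j t \<le> 2 * c" using M_bound[OF ij t] by (auto simp: P_def c_def) }
    assume "t \<in> {a..b} - Z"
    then show "continuous (at t within {a..b}) (P i j)"
      unfolding P_def using M_cont[OF ij] by (intro continuous_intros)
  qed (use assms in \<open>auto simp: c_def\<close>)
  define y where "y = (\<lambda>i t. exp (- c * (t - a)) * flow i t)"
  show thesis
  proof
    fix i assume i: "i < n"
    show "y i a = x i" using flow_start[OF i] by (simp add: y_def)
    show "abs_cont_on a b (y i)"
      unfolding y_def by (intro abs_cont_on_mult abs_cont_on_exp_decay flow_abs_cont i) (simp add: c_def)
    show "0 \<le> y i t" if "t \<in> {a..b}" for t using flow_bounded[OF i that] by (simp add: y_def)
    fix t assume t: "t \<in> {a..b} - Z"
    have "(\<Sum>j<n. P i j t * y j t) = (\<Sum>j<n. M i j t * y j t) + (\<Sum>j<n. if i = j then c * y j t else 0)"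
      by (simp add: P_def distrib_right if_distrib[of "\<lambda>z. z * _"] sum.distrib cong: if_cong)
    then have sum: "(\<Sum>j<n. M i j t * y j t) = (\<Sum>j<n. P i j t * y j t) - c * y i t"
      using i by simp
    have "(y i has_real_derivative
        exp (- c * (t - a)) * rhs flow i t + exp (- c * (t - a)) * (- c) * flow i t) (at t within {a..b})"
      unfolding y_def by (auto intro!: derivative_eq_intros flow_deriv[OF i t])
    also have "exp (- c * (t - a)) * rhs flow i t + exp (- c * (t - a)) * (- c) * flow i t
        = (\<Sum>j<n. M i j t * y j t)"
      unfolding sum by (simp add: rhs_def y_def sum_distrib_left mult_ac)
    finally show "(y i has_real_derivative (\<Sum>j<n. M i j t * y j t)) (at t within {a..b})" .
  qed
qed

section \<open>The game under sign feedback\<close>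

lemma mat_vec_index:
  assumes "M \<in> carrier_mat a b" "v \<in> carrier_vec b" "k < a"
  shows "(M *\<^sub>v v) $ k = (\<Sum>l<b. M $$ (k, l) * v $ l)"
  using assms by (simp add: scalar_prod_def atLeast0LessThan)

lemma mult_mat_vec_rows: "M \<in> carrier_mat a b \<Longrightarrow> M *\<^sub>v v \<in> carrier_vec a"
  by (auto intro: carrier_vecI)

lemma transpose_mult_vec_cols: "M \<in> carrier_mat a b \<Longrightarrow> M\<^sup>T *\<^sub>v v \<in> carrier_vec b"
  by (auto intro: carrier_vecI)

lemma scalar_prod_vec_sum:
  fixes v :: rvec
  assumes "finite I" "v \<in> carrier_vec n" "f \<in> I \<rightarrow> carrier_vec n"
  shows "v \<bullet> vec_sum n f I = (\<Sum>i\<in>I. v \<bullet> f i)"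
proof -
  have "v \<bullet> vec_sum n f I = (\<Sum>k<n. \<Sum>i\<in>I. v $ k * f i $ k)"
    using assms finsum_vec_closed[OF assms(3)]
    by (auto simp: scalar_prod_def atLeast0LessThan index_finsum_vec sum_distrib_left)
  also have "\<dots> = (\<Sum>i\<in>I. \<Sum>k<n. v $ k * f i $ k)" by (rule sum.swap)
  also have "\<dots> = (\<Sum>i\<in>I. v \<bullet> f i)"
    using assms(3) by (intro sum.cong refl) (auto simp: scalar_prod_def atLeast0LessThan Pi_iff)
  finally show ?thesis .
qed

lemma scalar_prod_index: "(w :: rvec) \<in> carrier_vec n \<Longrightarrow> v \<bullet> w = (\<Sum>k<n. v $ k * w $ k)"
  by (simp add: scalar_prod_def atLeast0LessThan)

lemma uminus_combination_scalar_prod: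
  fixes a b c d x :: rvec
  assumes "a \<in> carrier_vec n" "b \<in> carrier_vec n" "c \<in> carrier_vec n" "d \<in> carrier_vec n"
    and x: "x \<in> carrier_vec n"
  shows "- (a + b - c - d) \<bullet> x = - (a \<bullet> x + b \<bullet> x - c \<bullet> x - d \<bullet> x)"
proof -
  have "(- (a + b - c - d)) $ k * x $ k = - (a $ k * x $ k + b $ k * x $ k - c $ k * x $ k - d $ k * x $ k)"
    if "k < n" for k
    using assms that by (simp add: algebra_simps)
  then have "(\<Sum>k<n. (- (a + b - c - d)) $ k * x $ k)
      = (\<Sum>k<n. - (a $ k * x $ k + b $ k * x $ k - c $ k * x $ k - d $ k * x $ k))"
    by (intro sum.cong) auto
  then show ?thesis
    by (simp add: scalar_prod_index[OF x] sum_negf sum_subtractf sum.distrib)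
qed

lemma nonneg_orthant_iff: "v \<in> nonneg_orthant n \<longleftrightarrow> v \<in> carrier_vec n \<and> (\<forall>k<n. 0 \<le> v $ k)"
proof (cases "v \<in> carrier_vec n")
  case True
  then have "dim_vec v = n" by (rule carrier_vecD)
  with True show ?thesis
    unfolding nonneg_orthant_def less_eq_vec_def by (simp only: mem_Collect_eq index_zero_vec simp_thms) simp
qed (simp add: nonneg_orthant_def)

lemma sign_set_abs: "v \<in> sign_set z \<Longrightarrow> \<bar>v\<bar> \<le> 1"
  by (auto simp: sign_set_def split: if_splits)

text \<open>For z = 0 both sides vanish whatever v in [-1, 1] is chosen. Hence every selection from
  the sign sets is optimal, and the cost estimates hold at every time.\<close>

lemma sign_set_mult: "v \<in> sign_set z \<Longrightarrow> z * v = \<bar>z\<bar>"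
  by (auto simp: sign_set_def split: if_splits)

lemma sign_set_nonzero: "\<lbrakk>v \<in> sign_set z; z \<noteq> 0\<rbrakk> \<Longrightarrow> v = sgn z"
  by (auto simp: sign_set_def split: if_splits)

lemma sign_gainsE:
  assumes "M \<in> sign_gains E z" "E \<in> carrier_mat a b" "z \<in> carrier_vec a"
  obtains v where "v \<in> carrier_vec a" "\<And>j. j < a \<Longrightarrow> v $ j \<in> sign_set (z $ j)"
    "M \<in> carrier_mat a b" "\<And>j l. \<lbrakk>j < a; l < b\<rbrakk> \<Longrightarrow> M $$ (j, l) = v $ j * E $$ (j, l)"
proof -
  obtain v where v: "v \<in> carrier_vec a" "\<And>j. j < a \<Longrightarrow> v $ j \<in> sign_set (z $ j)"
    and M: "M = diag_of_vec v * E"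
    using assms by (auto simp: sign_gains_def sign_vec_set_def)
  have "M = mat a b (\<lambda>(j,l). v $ j * E $$ (j, l))"
    using v(1) assms(2) unfolding M diag_of_vec_def by (simp add: mat_diag_mult_left[of E a b])
  then show thesis using that[OF v] by simp
qed

lemma has_vec_derivD:
  assumes "has_vec_deriv f v F" "v \<in> carrier_vec n" "k < n"
  shows "((\<lambda>\<tau>. f \<tau> $ k) has_real_derivative v $ k) F"
  using assms by (simp add: has_vec_deriv_def)

lemma ae_onE:
  assumes "AE x\<in>S in lebesgue. P x"
  obtains Z where "negligible Z" "\<And>x. x \<in> S - Z \<Longrightarrow> P x"
  using assms unfolding eventually_ae_filter_negligible by blast

section \<open>Sign feedback as pointwise minimiser\<close>

locale sign_feedback_game =
  fixes N n :: nat and m :: "nat \<Rightarrow> nat" and T :: real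
    and A :: rmat and B E :: "nat \<Rightarrow> rmat" and s r :: "nat \<Rightarrow> rvec"
    and p :: "nat \<Rightarrow> real \<Rightarrow> rvec" and K :: "nat \<Rightarrow> real \<Rightarrow> rmat"
  assumes A: "A \<in> carrier_mat n n"
    and B: "\<And>i. i < N \<Longrightarrow> B i \<in> carrier_mat n (m i)"
    and E: "\<And>i. i < N \<Longrightarrow> E i \<in> carrier_mat (m i) n \<and> 0\<^sub>m (m i) n \<le> E i"
    and s: "\<And>i. i < N \<Longrightarrow> s i \<in> carrier_vec n"
    and r: "\<And>i. i < N \<Longrightarrow> r i \<in> carrier_vec (m i)"
    and metzler: "metzler (A - mat_sum n n (\<lambda>i. mat_abs (B i) * E i) {..<N})"
    and K: "\<And>i t. \<lbrakk>i < N; t \<in> {0..T}\<rbrakk> \<Longrightarrow> K i t \<in> sign_gains (E i) (r i + (B i)\<^sup>T *\<^sub>v p i t)"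
    and p_abs_cont: "\<And>i. i < N \<Longrightarrow> vec_abs_cont_on n 0 T (p i)"
    and p_final: "\<And>i. i < N \<Longrightarrow> p i T = 0\<^sub>v n"
    and p_deriv: "\<And>i. i < N \<Longrightarrow> AE t\<in>{0..T} in lebesgue.
           has_vec_deriv (p i)
             (- (s i + (A\<^sup>T *\<^sub>v p i t) - (K i t)\<^sup>T *\<^sub>v (r i + (B i)\<^sup>T *\<^sub>v p i t)
                 - vec_sum n (\<lambda>j. (K j t)\<^sup>T *\<^sub>v ((B j)\<^sup>T *\<^sub>v p i t)) ({..<N} - {i})))
             (at t within {0..T})"
    and nonzero: "\<And>i. i < N \<Longrightarrow> AE t\<in>{0..T} in lebesgue.
           \<forall>j<m i. (r i + (B i)\<^sup>T *\<^sub>v p i t) $ j \<noteq> 0"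
begin

abbreviation switching :: "nat \<Rightarrow> real \<Rightarrow> rvec" where
  "switching i t \<equiv> r i + (B i)\<^sup>T *\<^sub>v p i t"

abbreviation sign_feedback :: "nat \<Rightarrow> feedback" where
  "sign_feedback \<equiv> \<lambda>i t x. - (K i t *\<^sub>v x)"

lemma p_carrier: "\<lbrakk>i < N; t \<in> {0..T}\<rbrakk> \<Longrightarrow> p i t \<in> carrier_vec n"
  using p_abs_cont by (simp add: vec_abs_cont_on_def)

text \<open>The dimension of a sum of vectors is that of its second summand, here the number of
  columns of \<open>B i\<close>; so no condition on \<open>t\<close> appears.\<close>

lemma switching_carrier: "i < N \<Longrightarrow> switching i t \<in> carrier_vec (m i)"
  using carrier_matD(2)[OF B] by (intro carrier_vecI) simp

lemma ex_gain:
  assumes "i < N" "t \<in> {0..T}"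
  shows "\<exists>v. (\<forall>j<m i. v $ j \<in> sign_set (switching i t $ j)) \<and> K i t \<in> carrier_mat (m i) n \<and>
    (\<forall>j<m i. \<forall>l<n. K i t $$ (j, l) = v $ j * E i $$ (j, l))"
  using sign_gainsE[OF K[OF assms] _ switching_carrier[OF assms(1)]] E[OF assms(1)] by metis

lemma K_carrier: "\<lbrakk>i < N; t \<in> {0..T}\<rbrakk> \<Longrightarrow> K i t \<in> carrier_mat (m i) n"
  using ex_gain by blast

lemma K_transpose_mult_carrier:
  "\<lbrakk>i < N; t \<in> {0..T}\<rbrakk> \<Longrightarrow> (K i t)\<^sup>T *\<^sub>v v \<in> carrier_vec n"
  by (rule transpose_mult_vec_cols[OF K_carrier])

lemma B_mult_carrier: "i < N \<Longrightarrow> B i *\<^sub>v v \<in> carrier_vec n"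
  by (rule mult_mat_vec_rows[OF B])

lemma ex_gain_mult:
  assumes i: "i < N" and t: "t \<in> {0..T}" and x: "x \<in> carrier_vec n"
  shows "\<exists>v. \<forall>j<m i. v $ j \<in> sign_set (switching i t $ j) \<and>
    (K i t *\<^sub>v x) $ j = v $ j * (E i *\<^sub>v x) $ j"
proof -
  obtain v where v: "\<forall>j<m i. v $ j \<in> sign_set (switching i t $ j)"
    "\<forall>j<m i. \<forall>l<n. K i t $$ (j, l) = v $ j * E i $$ (j, l)"
    using ex_gain[OF i t] by blast
  have "(K i t *\<^sub>v x) $ j = v $ j * (E i *\<^sub>v x) $ j" if j: "j < m i" for j
  proof -
    have "(K i t *\<^sub>v x) $ j = (\<Sum>l<n. K i t $$ (j, l) * x $ l)"
      by (rule mat_vec_index[OF K_carrier[OF i t] x j])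
    also have "\<dots> = (\<Sum>l<n. v $ j * (E i $$ (j, l) * x $ l))"
      using v(2) j by (intro sum.cong) (auto simp: mult.assoc)
    also have "\<dots> = v $ j * (E i *\<^sub>v x) $ j"
      using mat_vec_index[OF conjunct1[OF E[OF i]] x j] by (simp only: sum_distrib_left)
    finally show ?thesis .
  qed
  then show ?thesis using v(1) by blast
qed

lemma E_nonneg: "\<lbrakk>i < N; j < m i; l < n\<rbrakk> \<Longrightarrow> 0 \<le> E i $$ (j, l)"
  using E[of i, THEN conjunct2, unfolded less_eq_mat_def, THEN conjunct2, THEN conjunct2]
    carrier_matD[OF E[of i, THEN conjunct1]] by fastforce

lemma vec_abs_leD:
  assumes "i < N" "vec_abs u \<le> E i *\<^sub>v x"
  shows "u \<in> carrier_vec (m i)" "\<And>j. j < m i \<Longrightarrow> \<bar>u $ j\<bar> \<le> (E i *\<^sub>v x) $ j"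
proof -
  have row: "dim_row (E i) = m i" using E[OF assms(1)] by blast
  have dim: "dim_vec u = m i" and le: "\<forall>j<m i. vec_abs u $ j \<le> (E i *\<^sub>v x) $ j"
    using assms(2) unfolding less_eq_vec_def dim_mult_mat_vec row index_map_vec(2) by blast+
  show "u \<in> carrier_vec (m i)" using dim by (rule carrier_vecI)
  show "\<bar>u $ j\<bar> \<le> (E i *\<^sub>v x) $ j" if "j < m i" for j
    using le that dim by simp
qed

text \<open>Each entry of K x is the entry of E x multiplied by a number in [-1, 1], and E x is
  nonnegative because \<open>E\<close> and \<open>x\<close> are.\<close>

lemma sign_feedback_bound:
  assumes i: "i < N" and t: "t \<in> {0..T}" and x: "x \<in> nonneg_orthant n"
  shows "vec_abs (sign_feedback i t x) \<le> E i *\<^sub>v x"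
proof -
  have xc: "x \<in> carrier_vec n" using x by (simp add: nonneg_orthant_iff)
  have x0: "0 \<le> x $ l" if "l < n" for l using x that by (simp add: nonneg_orthant_iff)
  obtain v where v: "\<forall>j<m i. v $ j \<in> sign_set (switching i t $ j) \<and>
      (K i t *\<^sub>v x) $ j = v $ j * (E i *\<^sub>v x) $ j"
    using ex_gain_mult[OF i t xc] by blast
  have "\<bar>(K i t *\<^sub>v x) $ j\<bar> \<le> (E i *\<^sub>v x) $ j" if j: "j < m i" for j
  proof -
    have "0 \<le> (E i *\<^sub>v x) $ j"
      unfolding mat_vec_index[OF conjunct1[OF E[OF i]] xc j]
      using E_nonneg[OF i j] x0 by (intro sum_nonneg mult_nonneg_nonneg) auto
    moreover have "\<bar>v $ j\<bar> \<le> 1" using v j sign_set_abs by blast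
    ultimately show ?thesis using v j by (simp add: abs_mult mult_left_le_one_le)
  qed
  then show ?thesis
    using carrier_matD(1)[OF K_carrier[OF i t]] carrier_matD(1)[OF conjunct1[OF E[OF i]]]
    unfolding less_eq_vec_def by simp
qed

text \<open>Over the box |u| \<le> E x the linear function y \<bullet> u is smallest at u = - K x,
  with minimum - |y| \<bullet> (E x). The state is only assumed to have dimension n: the constraint
  on u already forces E x to be nonnegative.\<close>

lemma sign_feedback_optimal:
  assumes i: "i < N" and t: "t \<in> {0..T}" and x: "x \<in> carrier_vec n"
    and u: "vec_abs u \<le> E i *\<^sub>v x"
  shows "0 \<le> switching i t \<bullet> (K i t *\<^sub>v x) + switching i t \<bullet> u"
proof -
  obtain v where v: "\<forall>j<m i. v $ j \<in> sign_set (switching i t $ j) \<and>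
      (K i t *\<^sub>v x) $ j = v $ j * (E i *\<^sub>v x) $ j"
    using ex_gain_mult[OF i t x] by blast
  have dims: "dim_vec u = m i" "dim_vec (K i t *\<^sub>v x) = m i"
    using vec_abs_leD(1)[OF i u] K_carrier[OF i t] by auto
  have "0 \<le> switching i t $ j * (K i t *\<^sub>v x) $ j + switching i t $ j * u $ j" if j: "j < m i" for j
  proof -
    have "\<bar>u $ j\<bar> \<le> (E i *\<^sub>v x) $ j" by (rule vec_abs_leD(2)[OF i u j])
    then have "\<bar>switching i t $ j * u $ j\<bar> \<le> \<bar>switching i t $ j\<bar> * (E i *\<^sub>v x) $ j"
      unfolding abs_mult by (intro mult_left_mono) auto
    also have "\<dots> = switching i t $ j * (K i t *\<^sub>v x) $ j"
      using sign_set_mult v j by (metis mult.assoc)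
    finally show ?thesis by linarith
  qed
  then show ?thesis
    unfolding scalar_prod_def dims sum.distrib[symmetric] by (intro sum_nonneg) auto
qed

text \<open>The Hamilton-Jacobi-Bellman identity for the linear value function p i t \<bullet> x; by
  sign_feedback_optimal the first two terms on the right add up to something nonnegative.\<close>

lemma value_derivative:
  assumes i: "i < N" and t: "t \<in> {0..T}" and x: "x \<in> carrier_vec n"
    and u: "u i \<in> carrier_vec (m i)"
    and others: "\<And>j. \<lbrakk>j < N; j \<noteq> i\<rbrakk> \<Longrightarrow> u j = - (K j t *\<^sub>v x)"
  shows "- (s i + (A\<^sup>T *\<^sub>v p i t) - (K i t)\<^sup>T *\<^sub>v switching i t
            - vec_sum n (\<lambda>j. (K j t)\<^sup>T *\<^sub>v ((B j)\<^sup>T *\<^sub>v p i t)) ({..<N} - {i})) \<bullet> x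
       + p i t \<bullet> (A *\<^sub>v x + vec_sum n (\<lambda>j. B j *\<^sub>v u j) {..<N})
       = switching i t \<bullet> (K i t *\<^sub>v x) + switching i t \<bullet> u i - (s i \<bullet> x + r i \<bullet> u i)"
proof -
  note p = p_carrier[OF i t]
  have uj: "u j \<in> carrier_vec (m j)" if "j < N" for j
    using u others[OF that] K_carrier[OF that t] x by (cases "j = i") auto
  let ?J = "{..<N} - {i}"
  let ?F = "\<lambda>j. (K j t)\<^sup>T *\<^sub>v ((B j)\<^sup>T *\<^sub>v p i t)"
  have Fc: "?F \<in> ?J \<rightarrow> carrier_vec n" using K_transpose_mult_carrier[OF _ t] by auto
  then have FS: "vec_sum n ?F ?J \<in> carrier_vec n" by (rule finsum_vec_closed)
  have Gc: "(\<lambda>j. B j *\<^sub>v u j) \<in> {..<N} \<rightarrow> carrier_vec n" using B_mult_carrier by auto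
  then have GS: "vec_sum n (\<lambda>j. B j *\<^sub>v u j) {..<N} \<in> carrier_vec n" by (rule finsum_vec_closed)
  have KT: "(K i t)\<^sup>T *\<^sub>v switching i t \<in> carrier_vec n" by (rule K_transpose_mult_carrier[OF i t])
  have AT: "A\<^sup>T *\<^sub>v p i t \<in> carrier_vec n" by (rule transpose_mult_vec_cols[OF A])
  have "vec_sum n ?F ?J \<bullet> x = x \<bullet> vec_sum n ?F ?J" by (rule comm_scalar_prod[OF FS x])
  also have "\<dots> = (\<Sum>j\<in>?J. x \<bullet> ?F j)" by (rule scalar_prod_vec_sum[OF _ x Fc]) simp
  also have "\<dots> = (\<Sum>j\<in>?J. p i t \<bullet> (B j *\<^sub>v (K j t *\<^sub>v x)))"
  proof (rule sum.cong[OF refl])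
    fix j assume "j \<in> ?J"
    then have j: "j < N" by simp
    note Kj = K_carrier[OF j t] and Bj = B[OF j]
    have "x \<bullet> ?F j = ?F j \<bullet> x" by (rule comm_scalar_prod[OF x K_transpose_mult_carrier[OF j t]])
    also have "\<dots> = ((B j)\<^sup>T *\<^sub>v p i t) \<bullet> (K j t *\<^sub>v x)"
      by (rule transpose_vec_mult_scalar[OF Kj x transpose_mult_vec_cols[OF Bj]])
    also have "\<dots> = p i t \<bullet> (B j *\<^sub>v (K j t *\<^sub>v x))"
      by (rule transpose_vec_mult_scalar[OF Bj mult_mat_vec_rows[OF Kj] p])
    finally show "x \<bullet> ?F j = p i t \<bullet> (B j *\<^sub>v (K j t *\<^sub>v x))" .
  qed
  finally have F: "vec_sum n ?F ?J \<bullet> x = (\<Sum>j\<in>?J. p i t \<bullet> (B j *\<^sub>v (K j t *\<^sub>v x)))" .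
  have "p i t \<bullet> vec_sum n (\<lambda>j. B j *\<^sub>v u j) {..<N} = (\<Sum>j<N. p i t \<bullet> (B j *\<^sub>v u j))"
    by (rule scalar_prod_vec_sum[OF _ p Gc]) simp
  also have "\<dots> = p i t \<bullet> (B i *\<^sub>v u i) + (\<Sum>j\<in>?J. p i t \<bullet> (B j *\<^sub>v u j))"
    using i by (intro sum.remove) auto
  also have "(\<Sum>j\<in>?J. p i t \<bullet> (B j *\<^sub>v u j)) = (\<Sum>j\<in>?J. - (p i t \<bullet> (B j *\<^sub>v (K j t *\<^sub>v x))))"
  proof (rule sum.cong[OF refl])
    fix j assume "j \<in> ?J"
    then have j: "j < N" "j \<noteq> i" by auto
    note Kj = K_carrier[OF j(1) t] and Bj = B[OF j(1)]
    have Kx: "K j t *\<^sub>v x \<in> carrier_vec (m j)" by (rule mult_mat_vec_rows[OF Kj])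
    have "p i t \<bullet> (B j *\<^sub>v u j) = ((B j)\<^sup>T *\<^sub>v p i t) \<bullet> (- (K j t *\<^sub>v x))"
      using transpose_vec_mult_scalar[OF Bj uj[OF j(1)] p] others[OF j] by simp
    also have "\<dots> = - (((B j)\<^sup>T *\<^sub>v p i t) \<bullet> (K j t *\<^sub>v x))"
      using transpose_mult_vec_cols[OF Bj] Kx by (intro scalar_prod_uminus_right) (metis carrier_vecD)
    also have "((B j)\<^sup>T *\<^sub>v p i t) \<bullet> (K j t *\<^sub>v x) = p i t \<bullet> (B j *\<^sub>v (K j t *\<^sub>v x))"
      by (rule transpose_vec_mult_scalar[OF Bj Kx p])
    finally show "p i t \<bullet> (B j *\<^sub>v u j) = - (p i t \<bullet> (B j *\<^sub>v (K j t *\<^sub>v x)))" .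
  qed
  also have "p i t \<bullet> (B i *\<^sub>v u i) = ((B i)\<^sup>T *\<^sub>v p i t) \<bullet> u i"
    by (rule transpose_vec_mult_scalar[OF B[OF i] u p, symmetric])
  \<comment> \<open>The last term is the coupling term of the equation for \<open>p i\<close> with
    the opposite sign; the two cancel in the total derivative, so the other players leave no trace
    in it.\<close>
  finally have G: "p i t \<bullet> vec_sum n (\<lambda>j. B j *\<^sub>v u j) {..<N}
      = ((B i)\<^sup>T *\<^sub>v p i t) \<bullet> u i - vec_sum n ?F ?J \<bullet> x"
    unfolding F by (simp add: sum_negf)
  have S: "switching i t \<bullet> u i = r i \<bullet> u i + ((B i)\<^sup>T *\<^sub>v p i t) \<bullet> u i"
    by (rule add_scalar_prod_distrib[OF r[OF i] transpose_mult_vec_cols[OF B[OF i]] u])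
  have "((K i t)\<^sup>T *\<^sub>v switching i t) \<bullet> x = switching i t \<bullet> (K i t *\<^sub>v x)"
    by (rule transpose_vec_mult_scalar[OF K_carrier[OF i t] x switching_carrier[OF i]])
  moreover have "(A\<^sup>T *\<^sub>v p i t) \<bullet> x = p i t \<bullet> (A *\<^sub>v x)"
    by (rule transpose_vec_mult_scalar[OF A x p])
  moreover have "p i t \<bullet> (A *\<^sub>v x + vec_sum n (\<lambda>j. B j *\<^sub>v u j) {..<N})
      = p i t \<bullet> (A *\<^sub>v x) + p i t \<bullet> vec_sum n (\<lambda>j. B j *\<^sub>v u j) {..<N}"
    by (rule scalar_prod_add_distrib[OF p mult_mat_vec_rows[OF A] GS])
  moreover have "- (s i + (A\<^sup>T *\<^sub>v p i t) - (K i t)\<^sup>T *\<^sub>v switching i t - vec_sum n ?F ?J) \<bullet> x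
      = - (s i \<bullet> x + (A\<^sup>T *\<^sub>v p i t) \<bullet> x - ((K i t)\<^sup>T *\<^sub>v switching i t) \<bullet> x - vec_sum n ?F ?J \<bullet> x)"
    by (rule uminus_combination_scalar_prod[OF s[OF i] AT KT FS x])
  ultimately show ?thesis using G S by simp
qed

section \<open>Costs along closed-loop trajectories\<close>

text \<open>The integrand is the almost everywhere derivative of the value along the trajectory,
  which vanishes at \<open>T\<close> and starts at \<open>p i t \<bullet> x\<close>. It is kept in
  one piece because its terms need not be integrable separately when the input of player
  \<open>i\<close> is not measurable.\<close>

lemma value_integral:
  assumes i: "i < N" and t: "t \<in> {0..T}"
    and others: "\<And>j. \<lbrakk>j < N; j \<noteq> i\<rbrakk> \<Longrightarrow> \<sigma> j = sign_feedback j"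
    and sol: "closed_loop_solution N n T A B E \<sigma> t x \<xi>"
  shows "((\<lambda>\<tau>. switching i \<tau> \<bullet> (K i \<tau> *\<^sub>v \<xi> \<tau>) + switching i \<tau> \<bullet> \<sigma> i \<tau> (\<xi> \<tau>)
           - running_cost s r \<sigma> i \<xi> \<tau>) has_integral - (p i t \<bullet> x)) {t..T}"
proof -
  let ?h = "\<lambda>\<tau>. switching i \<tau> \<bullet> (K i \<tau> *\<^sub>v \<xi> \<tau>) + switching i \<tau> \<bullet> \<sigma> i \<tau> (\<xi> \<tau>) - running_cost s r \<sigma> i \<xi> \<tau>"
  have sub: "{t..T} \<subseteq> {0..T}" using t by auto
  have ac: "vec_abs_cont_on n t T \<xi>" and start: "\<xi> t = x"
    and bound: "\<And>\<tau> j. \<lbrakk>\<tau> \<in> {t..T}; j < N\<rbrakk> \<Longrightarrow> vec_abs (\<sigma> j \<tau> (\<xi> \<tau>)) \<le> E j *\<^sub>v \<xi> \<tau>"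
    and ode: "AE \<tau>\<in>{t..T} in lebesgue. has_vec_deriv \<xi> (A *\<^sub>v \<xi> \<tau> + vec_sum n (\<lambda>i. B i *\<^sub>v \<sigma> i \<tau> (\<xi> \<tau>)) {..<N})
          (at \<tau> within {t..T})"
    using sol by (auto simp: closed_loop_solution_def)
  have \<xi>: "\<xi> \<tau> \<in> carrier_vec n" if "\<tau> \<in> {t..T}" for \<tau> using ac that by (simp add: vec_abs_cont_on_def)
  obtain Z1 where Z1: "negligible Z1" "\<And>\<tau>. \<tau> \<in> {t..T} - Z1 \<Longrightarrow>
      has_vec_deriv \<xi> (A *\<^sub>v \<xi> \<tau> + vec_sum n (\<lambda>i. B i *\<^sub>v \<sigma> i \<tau> (\<xi> \<tau>)) {..<N}) (at \<tau> within {t..T})"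
    using ae_onE[OF ode] by blast
  obtain Z2 where Z2: "negligible Z2" "\<And>\<tau>. \<tau> \<in> {0..T} - Z2 \<Longrightarrow> has_vec_deriv (p i)
             (- (s i + (A\<^sup>T *\<^sub>v p i \<tau>) - (K i \<tau>)\<^sup>T *\<^sub>v switching i \<tau>
                 - vec_sum n (\<lambda>j. (K j \<tau>)\<^sup>T *\<^sub>v ((B j)\<^sup>T *\<^sub>v p i \<tau>)) ({..<N} - {i})))
             (at \<tau> within {0..T})"
    using ae_onE[OF p_deriv[OF i]] by blast
  \<comment> \<open>The coordinate sum lets the rules for sums and products of real functions apply.
    It agrees with the scalar product at the times where the trajectory is known to have dimension
    n.\<close>
  define g where "g = (\<lambda>\<tau>. \<Sum>k<n. p i \<tau> $ k * \<xi> \<tau> $ k)"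
  have g: "g \<tau> = p i \<tau> \<bullet> \<xi> \<tau>" if "\<tau> \<in> {t..T}" for \<tau>
    using \<xi>[OF that] by (simp add: g_def scalar_prod_index)
  have "abs_cont_on t T g"
    unfolding g_def
  proof (intro abs_cont_on_sum abs_cont_on_mult)
    fix k assume "k \<in> {..<n}"
    then show "abs_cont_on t T (\<lambda>\<tau>. \<xi> \<tau> $ k)" "abs_cont_on t T (\<lambda>\<tau>. p i \<tau> $ k)"
      using ac p_abs_cont[OF i] t
      by (auto simp: vec_abs_cont_on_def intro: abs_cont_on_subinterval[of 0 T])
  qed
  moreover have "(g has_real_derivative ?h \<tau>) (at \<tau> within {t..T})" if \<tau>: "\<tau> \<in> {t..T} - (Z1 \<union> Z2)" for \<tau>
  proof -
    let ?p' = "- (s i + (A\<^sup>T *\<^sub>v p i \<tau>) - (K i \<tau>)\<^sup>T *\<^sub>v switching i \<tau>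
                 - vec_sum n (\<lambda>j. (K j \<tau>)\<^sup>T *\<^sub>v ((B j)\<^sup>T *\<^sub>v p i \<tau>)) ({..<N} - {i}))"
    let ?x' = "A *\<^sub>v \<xi> \<tau> + vec_sum n (\<lambda>i. B i *\<^sub>v \<sigma> i \<tau> (\<xi> \<tau>)) {..<N}"
    have \<tau>0: "\<tau> \<in> {0..T}" and \<tau>t: "\<tau> \<in> {t..T}" using \<tau> sub by auto
    have "vec_sum n (\<lambda>i. B i *\<^sub>v \<sigma> i \<tau> (\<xi> \<tau>)) {..<N} \<in> carrier_vec n"
      using B_mult_carrier by (intro finsum_vec_closed) auto
    then have x': "?x' \<in> carrier_vec n" by (intro add_carrier_vec mult_mat_vec_rows[OF A])
    have "vec_sum n (\<lambda>j. (K j \<tau>)\<^sup>T *\<^sub>v ((B j)\<^sup>T *\<^sub>v p i \<tau>)) ({..<N} - {i}) \<in> carrier_vec n"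
      using K_transpose_mult_carrier[OF _ \<tau>0] by (intro finsum_vec_closed) auto
    from carrier_vecD[OF this] have p': "?p' \<in> carrier_vec n" by (intro carrier_vecI) simp
    have "((\<lambda>\<tau>. p i \<tau> $ k) has_real_derivative ?p' $ k) (at \<tau> within {t..T})" if "k < n" for k
    proof (rule DERIV_subset[OF _ sub])
      show "((\<lambda>\<tau>. p i \<tau> $ k) has_real_derivative ?p' $ k) (at \<tau> within {0..T})"
        using \<tau> \<tau>0 by (intro has_vec_derivD[OF Z2(2) p' that]) blast
    qed
    moreover have "((\<lambda>\<tau>. \<xi> \<tau> $ k) has_real_derivative ?x' $ k) (at \<tau> within {t..T})" if "k < n" for k
      using \<tau> by (intro has_vec_derivD[OF Z1(2) x' that]) blast
    ultimately have "(g has_real_derivative (\<Sum>k<n. ?p' $ k * \<xi> \<tau> $ k + ?x' $ k * p i \<tau> $ k)) (at \<tau> within {t..T})"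
      unfolding g_def by (intro DERIV_sum DERIV_mult) auto
    also have "(\<Sum>k<n. ?p' $ k * \<xi> \<tau> $ k + ?x' $ k * p i \<tau> $ k) = ?p' \<bullet> \<xi> \<tau> + p i \<tau> \<bullet> ?x'"
      using scalar_prod_index[OF \<xi>[OF \<tau>t]] scalar_prod_index[OF x']
      by (simp add: sum.distrib mult.commute)
    also have "\<dots> = ?h \<tau>"
    proof -
      have "\<sigma> i \<tau> (\<xi> \<tau>) \<in> carrier_vec (m i)"
        by (rule vec_abs_leD(1)[OF i bound[OF \<tau>t i]])
      then show ?thesis
        using value_derivative[OF i \<tau>0 \<xi>[OF \<tau>t], of "\<lambda>j. \<sigma> j \<tau> (\<xi> \<tau>)"] others
        by (simp add: running_cost_def)
    qed
    finally show ?thesis .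
  qed
  moreover have "negligible (Z1 \<union> Z2)" using Z1(1) Z2(1) by (rule negligible_Un)
  ultimately have "(?h has_integral (g T - g t)) {t..T}"
    using t by (intro abs_cont_on_fundamental_theorem[of t T g "Z1 \<union> Z2" ?h]) auto
  moreover have "g T = 0" using p_final[OF i] by (simp add: g_def)
  moreover have "g t = p i t \<bullet> x" using g[of t] t start by simp
  ultimately show ?thesis by simp
qed

text \<open>Minus the running cost lies below the integrand of \<open>value_integral\<close> by a
  nonnegative gap, so comparing these two integrals suffices and the gap itself is never integrated.
  The estimate concerns one trajectory at a time and thus covers each of several solutions under a
  deviation.\<close>

lemma value_le_cost:
  assumes i: "i < N" and t: "t \<in> {0..T}"
    and others: "\<And>j. \<lbrakk>j < N; j \<noteq> i\<rbrakk> \<Longrightarrow> \<sigma> j = sign_feedback j"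
    and sol: "closed_loop_solution N n T A B E \<sigma> t x \<xi>"
    and "cost_defined T s r \<sigma> i t \<xi>"
  shows "p i t \<bullet> x \<le> cost T s r \<sigma> i t \<xi>"
proof -
  have "(running_cost s r \<sigma> i \<xi> has_integral cost T s r \<sigma> i t \<xi>) {t..T}"
    using assms(5) unfolding cost_def cost_defined_def by (rule integrable_integral)
  then have "((\<lambda>\<tau>. - running_cost s r \<sigma> i \<xi> \<tau>) has_integral - cost T s r \<sigma> i t \<xi>) {t..T}"
    by (rule has_integral_neg)
  then have "- cost T s r \<sigma> i t \<xi> \<le> - (p i t \<bullet> x)"
  proof (rule has_integral_le[OF _ value_integral[OF i t others sol]])
    fix \<tau> assume \<tau>: "\<tau> \<in> {t..T}"
    then have "0 \<le> switching i \<tau> \<bullet> (K i \<tau> *\<^sub>v \<xi> \<tau>) + switching i \<tau> \<bullet> \<sigma> i \<tau> (\<xi> \<tau>)"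
      using sol i t by (intro sign_feedback_optimal) (auto simp: closed_loop_solution_def vec_abs_cont_on_def)
    then show "- running_cost s r \<sigma> i \<xi> \<tau> \<le> switching i \<tau> \<bullet> (K i \<tau> *\<^sub>v \<xi> \<tau>)
        + switching i \<tau> \<bullet> \<sigma> i \<tau> (\<xi> \<tau>) - running_cost s r \<sigma> i \<xi> \<tau>" by simp
  qed
  then show ?thesis by simp
qed

text \<open>For u = - K x the gap vanishes identically, and the integral of the value derivative
  delivers existence and value of the cost together, whatever gains are selected at zeros of the
  switching functions.\<close>

lemma sign_feedback_cost:
  assumes i: "i < N" and t: "t \<in> {0..T}"
    and sol: "closed_loop_solution N n T A B E sign_feedback t x \<xi>"
  shows "cost_defined T s r sign_feedback i t \<xi>" "cost T s r sign_feedback i t \<xi> = p i t \<bullet> x"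
proof -
  have "((\<lambda>\<tau>. - running_cost s r sign_feedback i \<xi> \<tau>) has_integral - (p i t \<bullet> x)) {t..T}"
  proof (rule has_integral_eq[OF _ value_integral[OF i t refl sol]])
    fix \<tau> assume \<tau>: "\<tau> \<in> {t..T}"
    have "switching i \<tau> \<bullet> (- (K i \<tau> *\<^sub>v \<xi> \<tau>)) = - (switching i \<tau> \<bullet> (K i \<tau> *\<^sub>v \<xi> \<tau>))"
      using K_carrier[OF i, of \<tau>] B[OF i] \<tau> t by (intro scalar_prod_uminus_right) auto
    then show "switching i \<tau> \<bullet> (K i \<tau> *\<^sub>v \<xi> \<tau>) + switching i \<tau> \<bullet> sign_feedback i \<tau> (\<xi> \<tau>)
        - running_cost s r sign_feedback i \<xi> \<tau> = - running_cost s r sign_feedback i \<xi> \<tau>" by simp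
  qed
  from has_integral_neg[OF this]
  have "(running_cost s r sign_feedback i \<xi> has_integral p i t \<bullet> x) {t..T}" by simp
  then show "cost_defined T s r sign_feedback i t \<xi>" "cost T s r sign_feedback i t \<xi> = p i t \<bullet> x"
    by (auto simp: cost_defined_def cost_def)
qed

section \<open>Existence of closed-loop trajectories\<close>

lemma switching_nonzeroE:
  obtains Z where "negligible Z"
    "\<And>i t j. \<lbrakk>i < N; t \<in> {0..T} - Z; j < m i\<rbrakk> \<Longrightarrow> switching i t $ j \<noteq> 0"
proof -
  have "\<exists>Z. negligible Z \<and> (\<forall>t\<in>{0..T} - Z. \<forall>j<m i. switching i t $ j \<noteq> 0)" if "i < N" for i
    using ae_onE[OF nonzero[OF that]] by metis
  then obtain Z where Z: "\<And>i. i < N \<Longrightarrow> negligible (Z i)"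
    "\<And>i t j. \<lbrakk>i < N; t \<in> {0..T} - Z i; j < m i\<rbrakk> \<Longrightarrow> switching i t $ j \<noteq> 0" by metis
  show thesis
  proof (rule that)
    show "negligible (\<Union>i<N. Z i)" using Z(1) by (intro negligible_Union) auto
    show "switching i t $ j \<noteq> 0" if "i < N" "t \<in> {0..T} - (\<Union>i<N. Z i)" "j < m i" for i t j
      using Z(2)[OF that(1) _ that(3)] that by blast
  qed
qed

lemma switching_continuous:
  assumes i: "i < N" and j: "j < m i"
  shows "continuous_on {0..T} (\<lambda>t. switching i t $ j)"
proof -
  have "continuous_on {0..T} (\<lambda>t. r i $ j + (\<Sum>k<n. B i $$ (k, j) * p i t $ k))"
    using p_abs_cont[OF i]
    by (intro continuous_intros abs_cont_on_imp_continuous_on) (auto simp: vec_abs_cont_on_def)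
  moreover have "switching i t $ j = r i $ j + (\<Sum>k<n. B i $$ (k, j) * p i t $ k)" if "t \<in> {0..T}" for t
  proof -
    have BT: "(B i)\<^sup>T \<in> carrier_mat (m i) n" using B[OF i] by simp
    show ?thesis
      using mat_vec_index[OF BT p_carrier[OF i that] j] B[OF i] j by simp
  qed
  ultimately show ?thesis by (metis (no_types, lifting) continuous_on_eq)
qed

text \<open>At zeros of the switching functions the gains K are arbitrary, possibly non-measurable in t;
  sgn is 0 there, and the two matrices differ only on a null set.\<close>

definition closed_loop :: "nat \<Rightarrow> nat \<Rightarrow> real \<Rightarrow> real" where
  "closed_loop k l t = A $$ (k, l)
     - (\<Sum>q<N. \<Sum>j<m q. B q $$ (k, j) * (sgn (switching q t $ j) * E q $$ (j, l)))"

text \<open>The right-hand side is entry (k, l) of the sum of the |B q| E q, the matrix subtracted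
  from \<open>A\<close> in the second Metzler hypothesis. It depends neither on the signs nor on
  time, so it gives both the sign of the off-diagonal entries and a uniform bound.\<close>

lemma abs_coupling_le:
  assumes "l < n"
  shows "\<bar>\<Sum>q<N. \<Sum>j<m q. B q $$ (k, j) * (sgn (switching q t $ j) * E q $$ (j, l))\<bar>
    \<le> (\<Sum>q<N. \<Sum>j<m q. \<bar>B q $$ (k, j)\<bar> * E q $$ (j, l))"
proof -
  have le: "\<bar>sgn (switching q t $ j) * E q $$ (j, l)\<bar> \<le> E q $$ (j, l)" if "q < N" "j < m q" for q j
    using E_nonneg[OF that assms] by (simp add: abs_mult abs_sgn_eq)
  have "\<bar>\<Sum>q<N. \<Sum>j<m q. B q $$ (k, j) * (sgn (switching q t $ j) * E q $$ (j, l))\<bar>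
      \<le> (\<Sum>q<N. \<Sum>j<m q. \<bar>B q $$ (k, j) * (sgn (switching q t $ j) * E q $$ (j, l))\<bar>)"
    by (intro order_trans[OF sum_abs] sum_mono sum_abs)
  also have "\<dots> \<le> (\<Sum>q<N. \<Sum>j<m q. \<bar>B q $$ (k, j)\<bar> * E q $$ (j, l))"
    unfolding abs_mult[of "B _ $$ _"] using le by (intro sum_mono mult_left_mono) auto
  finally show ?thesis .
qed

text \<open>Whatever the signs are, an entry of the closed loop is at least the same entry of the
  worst-case matrix in the Metzler hypothesis.\<close>

lemma closed_loop_metzler:
  assumes "k < n" "l < n" "k \<noteq> l"
  shows "0 \<le> closed_loop k l t"
proof -
  let ?S = "mat_sum n n (\<lambda>i. mat_abs (B i) * E i) {..<N}"
  have "?S $$ (k, l) = (\<Sum>q<N. (mat_abs (B q) * E q) $$ (k, l))"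
    using assms by (simp add: mat_sum_def)
  also have "\<dots> = (\<Sum>q<N. \<Sum>j<m q. \<bar>B q $$ (k, j)\<bar> * E q $$ (j, l))"
  proof (rule sum.cong[OF refl])
    fix q assume "q \<in> {..<N}"
    then have "B q \<in> carrier_mat n (m q)" "E q \<in> carrier_mat (m q) n" using B E by auto
    then show "(mat_abs (B q) * E q) $$ (k, l) = (\<Sum>j<m q. \<bar>B q $$ (k, j)\<bar> * E q $$ (j, l))"
      using assms by (auto simp: scalar_prod_def atLeast0LessThan)
  qed
  finally have S: "?S $$ (k, l) = (\<Sum>q<N. \<Sum>j<m q. \<bar>B q $$ (k, j)\<bar> * E q $$ (j, l))" .
  have "0 \<le> (A - ?S) $$ (k, l)"
    using metzler assms unfolding metzler_def by (simp add: mat_sum_def)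
  also have "\<dots> = A $$ (k, l) - ?S $$ (k, l)"
    using assms by (intro index_minus_mat) (auto simp: mat_sum_def)
  finally have "0 \<le> A $$ (k, l) - ?S $$ (k, l)" .
  then show ?thesis
    using abs_coupling_le[OF assms(2), of k t] unfolding S closed_loop_def by linarith
qed

lemma closed_loop_bounded: "\<exists>C. \<forall>k<n. \<forall>l<n. \<forall>t. \<bar>closed_loop k l t\<bar> \<le> C"
proof -
  define W where "W = (\<lambda>k l. \<bar>A $$ (k, l)\<bar> + (\<Sum>q<N. \<Sum>j<m q. \<bar>B q $$ (k, j)\<bar> * E q $$ (j, l)))"
  have W: "\<bar>closed_loop k l t\<bar> \<le> W k l" if "l < n" for k l t
    using abs_coupling_le[OF that, of k t] unfolding W_def closed_loop_def by linarith
  then have W0: "0 \<le> W k l" if "l < n" for k l using that by (meson abs_ge_zero order_trans)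
  \<comment> \<open>The sum of all entry bounds serves as a single constant; unlike a maximum it
    needs no separate treatment of n = 0.\<close>
  have "\<bar>closed_loop k l t\<bar> \<le> (\<Sum>k<n. \<Sum>l<n. W k l)" if "k < n" "l < n" for k l t
  proof -
    have "W k l \<le> (\<Sum>l<n. W k l)" using that W0 by (intro member_le_sum) auto
    also have "\<dots> \<le> (\<Sum>k<n. \<Sum>l<n. W k l)"
      using that W0 by (intro member_le_sum[of k _ "\<lambda>k. \<Sum>l<n. W k l"] sum_nonneg) auto
    finally show ?thesis using W[OF that(2), of k t] by linarith
  qed
  then show ?thesis by blast
qed

lemma closed_loop_apply:
  assumes t: "t \<in> {0..T}" and nz: "\<And>q j. \<lbrakk>q < N; j < m q\<rbrakk> \<Longrightarrow> switching q t $ j \<noteq> 0"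
    and x: "x \<in> carrier_vec n" and k: "k < n"
  shows "(A *\<^sub>v x + vec_sum n (\<lambda>i. B i *\<^sub>v sign_feedback i t x) {..<N}) $ k
      = (\<Sum>l<n. closed_loop k l t * x $ l)"
proof -
  have Bu: "(\<lambda>i. B i *\<^sub>v sign_feedback i t x) \<in> {..<N} \<rightarrow> carrier_vec n" using B_mult_carrier by auto
  have one: "(B q *\<^sub>v sign_feedback q t x) $ k
      = - (\<Sum>l<n. (\<Sum>j<m q. B q $$ (k, j) * (sgn (switching q t $ j) * E q $$ (j, l))) * x $ l)" if q: "q < N" for q
  proof -
    obtain v where v: "\<forall>j<m q. v $ j \<in> sign_set (switching q t $ j)"
      "\<forall>j<m q. \<forall>l<n. K q t $$ (j, l) = v $ j * E q $$ (j, l)"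
      using ex_gain[OF q t] by blast
    \<comment> \<open>No entry of the switching vector vanishes here, so the sign set is a single
      point and the gain is forced to be the one given by \<open>sgn\<close>.\<close>
    have K: "K q t $$ (j, l) = sgn (switching q t $ j) * E q $$ (j, l)" if "j < m q" "l < n" for j l
      using v that sign_set_nonzero nz[OF q that(1)] by metis
    have u: "sign_feedback q t x \<in> carrier_vec (m q)"
      using mult_mat_vec_rows[OF K_carrier[OF q t]] by simp
    have "(B q *\<^sub>v sign_feedback q t x) $ k = (\<Sum>j<m q. B q $$ (k, j) * sign_feedback q t x $ j)"
      by (rule mat_vec_index[OF B[OF q] u k])
    also have "\<dots> = (\<Sum>j<m q. \<Sum>l<n. - (B q $$ (k, j) * (sgn (switching q t $ j) * E q $$ (j, l)) * x $ l))"
    proof (rule sum.cong[OF refl])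
      fix j assume "j \<in> {..<m q}"
      then have j: "j < m q" by simp
      have "sign_feedback q t x $ j = - (\<Sum>l<n. K q t $$ (j, l) * x $ l)"
        using mat_vec_index[OF K_carrier[OF q t] x j] K_carrier[OF q t] j by simp
      then show "B q $$ (k, j) * sign_feedback q t x $ j
          = (\<Sum>l<n. - (B q $$ (k, j) * (sgn (switching q t $ j) * E q $$ (j, l)) * x $ l))"
        using K[OF j] by (simp add: sum_distrib_left sum_negf mult.assoc)
    qed
    also have "\<dots> = (\<Sum>l<n. \<Sum>j<m q. - (B q $$ (k, j) * (sgn (switching q t $ j) * E q $$ (j, l)) * x $ l))"
      by (rule sum.swap)
    finally show ?thesis by (simp add: sum_negf sum_distrib_right)
  qed
  have "(A *\<^sub>v x + vec_sum n (\<lambda>i. B i *\<^sub>v sign_feedback i t x) {..<N}) $ k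
      = (A *\<^sub>v x) $ k + (\<Sum>q<N. (B q *\<^sub>v sign_feedback q t x) $ k)"
    using k finsum_vec_closed[OF Bu] index_finsum_vec[OF _ k Bu] by simp
  also have "(A *\<^sub>v x) $ k = (\<Sum>l<n. A $$ (k, l) * x $ l)" by (rule mat_vec_index[OF A x k])
  also have "(\<Sum>q<N. (B q *\<^sub>v sign_feedback q t x) $ k)
      = - (\<Sum>l<n. \<Sum>q<N. (\<Sum>j<m q. B q $$ (k, j) * (sgn (switching q t $ j) * E q $$ (j, l))) * x $ l)"
    using one by (subst sum.swap) (simp add: sum_negf)
  finally show ?thesis
    by (simp add: closed_loop_def sum_subtractf left_diff_distrib sum_distrib_right)
qed

lemma sign_feedback_solvable: "closed_loop_solvable N n T A B E sign_feedback"
  unfolding closed_loop_solvable_def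
proof (intro ballI)
  fix t x assume t: "t \<in> {0..T}" and x: "x \<in> nonneg_orthant n"
  have sub: "{t..T} \<subseteq> {0..T}" using t by auto
  obtain Z where Z: "negligible Z"
    "\<And>i t j. \<lbrakk>i < N; t \<in> {0..T} - Z; j < m i\<rbrakk> \<Longrightarrow> switching i t $ j \<noteq> 0"
    using switching_nonzeroE by blast
  obtain C where C: "\<And>k l t. \<lbrakk>k < n; l < n\<rbrakk> \<Longrightarrow> \<bar>closed_loop k l t\<bar> \<le> C"
    using closed_loop_bounded by blast
  \<comment> \<open>The switching functions are continuous and \<open>sgn\<close> is continuous at
    nonzero arguments, so jumps of the closed-loop matrix can only occur at times in
    \<open>Z\<close>.\<close>
  have cont: "continuous (at \<tau> within {t..T}) (closed_loop k l)" if \<tau>: "\<tau> \<in> {t..T} - Z" for k l \<tau>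
  proof -
    have "continuous (at \<tau> within {t..T}) (\<lambda>t. switching q t $ j)" if "q < N" "j < m q" for q j
      using switching_continuous[OF that] \<tau> sub
      by (meson DiffD1 continuous_on_eq_continuous_within continuous_within_subset subsetD)
    moreover have "\<tau> \<in> {0..T} - Z" using \<tau> sub by blast
    ultimately have "continuous (at \<tau> within {t..T}) (\<lambda>t. A $$ (k, l)
        - (\<Sum>q<N. \<Sum>j<m q. B q $$ (k, j) * (sgn (switching q t $ j) * E q $$ (j, l))))"
      using Z(2) by (intro continuous_intros continuous_at_within_sgn) auto
    then show ?thesis by (simp add: closed_loop_def[abs_def])
  qed
  have x0: "0 \<le> x $ k" if "k < n" for k using x that by (simp add: nonneg_orthant_iff)
  obtain y where y: "\<And>k. k < n \<Longrightarrow> y k t = x $ k" "\<And>k. k < n \<Longrightarrow> abs_cont_on t T (y k)"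
    "\<And>k \<tau>. \<lbrakk>k < n; \<tau> \<in> {t..T}\<rbrakk> \<Longrightarrow> 0 \<le> y k \<tau>"
    "\<And>k \<tau>. \<lbrakk>k < n; \<tau> \<in> {t..T} - Z\<rbrakk> \<Longrightarrow>
       (y k has_real_derivative (\<Sum>l<n. closed_loop k l \<tau> * y l \<tau>)) (at \<tau> within {t..T})"
    using metzler_system_solution[of t T Z n closed_loop C "\<lambda>k. x $ k"] t Z(1) C closed_loop_metzler cont x0
    by auto
  define \<xi> where "\<xi> = (\<lambda>\<tau>. vec n (\<lambda>k. y k \<tau>))"
  \<comment> \<open>Nonnegativity is more than a byproduct: a closed-loop solution has to satisfy
    the input constraint along its trajectory, and the sign feedback meets that bound on the
    orthant.\<close>
  have \<xi>0: "\<xi> \<tau> \<in> nonneg_orthant n" if "\<tau> \<in> {t..T}" for \<tau>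
    using y(3) that by (simp add: \<xi>_def nonneg_orthant_iff)
  have "closed_loop_solution N n T A B E sign_feedback t x \<xi>"
    unfolding closed_loop_solution_def
  proof (intro conjI ballI allI impI)
    show "vec_abs_cont_on n t T \<xi>" using y(2) by (simp add: vec_abs_cont_on_def \<xi>_def)
    show "\<xi> t = x" using y(1) x by (auto simp: \<xi>_def nonneg_orthant_iff)
    show "vec_abs (sign_feedback i \<tau> (\<xi> \<tau>)) \<le> E i *\<^sub>v \<xi> \<tau>" if "\<tau> \<in> {t..T}" "i < N" for \<tau> i
      using sign_feedback_bound[OF that(2) _ \<xi>0[OF that(1)]] sub that(1) by blast
    have "has_vec_deriv \<xi> (A *\<^sub>v \<xi> \<tau> + vec_sum n (\<lambda>i. B i *\<^sub>v sign_feedback i \<tau> (\<xi> \<tau>)) {..<N})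
        (at \<tau> within {t..T})" if \<tau>: "\<tau> \<in> {t..T} - Z" for \<tau>
    proof -
      let ?x' = "A *\<^sub>v \<xi> \<tau> + vec_sum n (\<lambda>i. B i *\<^sub>v sign_feedback i \<tau> (\<xi> \<tau>)) {..<N}"
      have "vec_sum n (\<lambda>i. B i *\<^sub>v sign_feedback i \<tau> (\<xi> \<tau>)) {..<N} \<in> carrier_vec n"
        using B_mult_carrier by (intro finsum_vec_closed) auto
      from carrier_vecD[OF this] have dim: "dim_vec ?x' = n" by simp
      have \<tau>0: "\<tau> \<in> {0..T}" "\<tau> \<in> {0..T} - Z" using \<tau> sub by auto
      have "((\<lambda>\<tau>. \<xi> \<tau> $ k) has_real_derivative ?x' $ k) (at \<tau> within {t..T})" if k: "k < n" for k
      proof -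
        have "?x' $ k = (\<Sum>l<n. closed_loop k l \<tau> * \<xi> \<tau> $ l)"
          using Z(2)[OF _ \<tau>0(2)] by (intro closed_loop_apply[OF \<tau>0(1) _ _ k]) (auto simp: \<xi>_def)
        then show ?thesis using y(4)[OF k \<tau>] k by (simp add: \<xi>_def)
      qed
      then show ?thesis unfolding has_vec_deriv_def dim by blast
    qed
    then show "AE \<tau>\<in>{t..T} in lebesgue. has_vec_deriv \<xi>
        (A *\<^sub>v \<xi> \<tau> + vec_sum n (\<lambda>i. B i *\<^sub>v sign_feedback i \<tau> (\<xi> \<tau>)) {..<N}) (at \<tau> within {t..T})"
      unfolding eventually_ae_filter_negligible using Z(1) by blast
  qed
  then show "\<exists>\<xi>. closed_loop_solution N n T A B E sign_feedback t x \<xi>" by blast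
qed

text \<open>Both costs are measured against the same number \<open>p i t \<bullet> x\<close>, an
  equality for the equilibrium and a lower bound for the deviation. The two trajectories are never
  compared with each other.\<close>

lemma sign_feedback_nash: "feedback_nash_equilibrium N n T A B E s r sign_feedback"
  unfolding feedback_nash_equilibrium_def
proof (intro conjI allI impI ballI)
  show "admissible_feedback n T (E i) (sign_feedback i)" if "i < N" for i
    using sign_feedback_bound[OF that] by (simp add: admissible_feedback_def)
  show "closed_loop_solvable N n T A B E sign_feedback" by (rule sign_feedback_solvable)
next
  fix t x \<xi> i
  assume "t \<in> {0..T}" "closed_loop_solution N n T A B E sign_feedback t x \<xi>" "i < N"
  then show "cost_defined T s r sign_feedback i t \<xi>" by (intro sign_feedback_cost(1))
next
  fix i \<nu> t x \<xi> \<eta>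
  let ?\<sigma> = "sign_feedback(i := \<nu>)"
  assume i: "i < N" and t: "t \<in> {0..T}"
    and "closed_loop_solution N n T A B E sign_feedback t x \<xi> \<and>
      closed_loop_solution N n T A B E ?\<sigma> t x \<eta> \<and> cost_defined T s r ?\<sigma> i t \<eta>"
  then have \<xi>: "closed_loop_solution N n T A B E sign_feedback t x \<xi>"
    and \<eta>: "closed_loop_solution N n T A B E ?\<sigma> t x \<eta>" "cost_defined T s r ?\<sigma> i t \<eta>" by auto
  have "p i t \<bullet> x \<le> cost T s r ?\<sigma> i t \<eta>"
    by (rule value_le_cost[OF i t _ \<eta>]) auto
  then show "cost T s r sign_feedback i t \<xi> \<le> cost T s r ?\<sigma> i t \<eta>"
    using sign_feedback_cost(2)[OF i t \<xi>] by simp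
qed

end

theorem theorem2:
  fixes N n :: nat and m :: "nat \<Rightarrow> nat" and T :: real
    and A :: rmat and B E :: "nat \<Rightarrow> rmat" and s r :: "nat \<Rightarrow> rvec" and x0 :: rvec
    and p :: "nat \<Rightarrow> real \<Rightarrow> rvec" and K :: "nat \<Rightarrow> real \<Rightarrow> rmat"
  assumes "N > 1" and "T > 0"
    and "A \<in> carrier_mat n n" and "metzler A"
    and "\<And>i. i < N \<Longrightarrow> B i \<in> carrier_mat n (m i)"
    and "\<And>i. i < N \<Longrightarrow> E i \<in> carrier_mat (m i) n \<and> 0\<^sub>m (m i) n \<le> E i"
    and "\<And>i. i < N \<Longrightarrow> s i \<in> nonneg_orthant n"
    and "\<And>i. i < N \<Longrightarrow> r i \<in> carrier_vec (m i)"
    and "x0 \<in> nonneg_orthant n"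
    and "metzler (A - mat_sum n n (\<lambda>i. mat_abs (B i) * E i) {..<N})"
    and "\<And>i. i < N \<Longrightarrow> vec_pos (s i - (E i)\<^sup>T *\<^sub>v vec_abs (r i))"
    and "\<And>i t. \<lbrakk>i < N; t \<in> {0..T}\<rbrakk> \<Longrightarrow>
           K i t \<in> sign_gains (E i) (r i + (B i)\<^sup>T *\<^sub>v p i t)"
    and "\<And>i. i < N \<Longrightarrow> vec_abs_cont_on n 0 T (p i)"
    and "\<And>i. i < N \<Longrightarrow> p i T = 0\<^sub>v n"
    and "\<And>i. i < N \<Longrightarrow> AE t\<in>{0..T} in lebesgue.
           has_vec_deriv (p i)
             (- (s i + (A\<^sup>T *\<^sub>v p i t) - (K i t)\<^sup>T *\<^sub>v (r i + (B i)\<^sup>T *\<^sub>v p i t)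
                 - vec_sum n (\<lambda>j. (K j t)\<^sup>T *\<^sub>v ((B j)\<^sup>T *\<^sub>v p i t)) ({..<N} - {i})))
             (at t within {0..T})"
    and "\<And>i. i < N \<Longrightarrow> AE t\<in>{0..T} in lebesgue.
           \<forall>j<m i. (r i + (B i)\<^sup>T *\<^sub>v p i t) $ j \<noteq> 0"
  shows "feedback_nash_equilibrium N n T A B E s r (\<lambda>i t x. - (K i t *\<^sub>v x)) \<and>
         (\<forall>\<xi>. closed_loop_solution N n T A B E (\<lambda>i t x. - (K i t *\<^sub>v x)) 0 x0 \<xi> \<longrightarrow>
            (\<forall>i<N. cost T s r (\<lambda>i t x. - (K i t *\<^sub>v x)) i 0 \<xi> = p i 0 \<bullet> x0))"
proof -
  interpret sign_feedback_game N n m T A B E s r p K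
  proof
    show "s i \<in> carrier_vec n" if "i < N" for i
      using assms(7)[OF that] by (simp add: nonneg_orthant_iff)
  qed (fact assms)+
  show ?thesis
    using sign_feedback_nash sign_feedback_cost(2)[of _ 0 x0] \<open>T > 0\<close> by auto
qed

end
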